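(* Let $\alpha>0$ and let $\psi:\mathbb R\to\mathbb C$ be an absolutely continuous $2\pi$-periodic function that satisfies, for (almost every) $k\in[-\pi,\pi]$: (i) $|\psi(k)|\le C|k|^\alpha$ for some $C>0$; (ii) $|\psi'(k)|\le C'|k|^{\alpha-1}$ for some $C'>0$; (iii) $\operatorname{Re}(\psi(k))\le -c|k|^\alpha$ for some $c>0$. Then $\psi\in W^1_{r,per}[-\pi,\pi]$, where $r=2$ if $\alpha>\frac12$ and $1<r<\frac1{1-\alpha}$ if $\alpha\le\frac12$. Moreover, there are constants $K$ and $M$ depending on $c$, $C$ and $C'$ (for the given $\alpha$) such that (a) $\|T_{e^{t\psi}}\|_{\mathcal B(L_1)}\le K$ for $t\ge0$; (b) $\|T_{\psi e^{t\psi}}\|_{\mathcal B(L_1)}\le\frac Mt$ for $t>0$.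
   Context: $L_1=L_1(\mathbb R)$ (complex-valued functions), with Fourier transform $\hat f(k)=\int_{-\infty}^\infty e^{ikx}f(x)\,dx$. A measurable function $\phi:\mathbb R\to\mathbb C$ is an $L_1$-multiplier if for every $f\in L_1$ there is $v\in L_1$ with $\phi\hat f=\hat v$; then $T_\phi:L_1\to L_1$, $T_\phi f:=v$, is a bounded operator, and $\|\cdot\|_{\mathcal B(L_1)}$ denotes the operator norm. (The estimates (a), (b) include the assertion that $e^{t\psi}$ and $\psi e^{t\psi}$ are $L_1$-multipliers.) $W^1_{r,per}[-\pi,\pi]$ is the Sobolev space of $2\pi$-periodic functions $g$ on $\mathbb R$ such that both $g$ and its generalized derivative $g'$ belong to $L_r[-\pi,\pi]$. *)

theory Defs
  imports "HOL-Analysis.Analysis"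
begin

text \<open>The elements of \<open>L\<^sub>1\<close> are represented by the functions themselves, not by their classes
  modulo equality almost everywhere.\<close>

definition L1 :: "(real \<Rightarrow> complex) set" where
  "L1 = {f. integrable lebesgue f}"

definition L1_norm :: "(real \<Rightarrow> complex) \<Rightarrow> real" where
  "L1_norm f = (\<integral>x. norm (f x) \<partial>lebesgue)"

definition fourier :: "(real \<Rightarrow> complex) \<Rightarrow> real \<Rightarrow> complex" where
  "fourier f k = (\<integral>x. exp (\<i> * of_real (k * x)) * f x \<partial>lebesgue)"

definition L1_multiplier :: "(real \<Rightarrow> complex) \<Rightarrow> bool" where
  "L1_multiplier \<phi> \<longleftrightarrow> \<phi> \<in> borel_measurable lebesgue \<and>
     (\<forall>f\<in>L1. \<exists>v\<in>L1. \<forall>k. \<phi> k * fourier f k = fourier v k)"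

text \<open>The function chosen here is unique up to equality almost everywhere, since the Fourier
  transform is injective on \<open>L\<^sub>1\<close>.\<close>

definition multiplier_op :: "(real \<Rightarrow> complex) \<Rightarrow> (real \<Rightarrow> complex) \<Rightarrow> real \<Rightarrow> complex" where
  "multiplier_op \<phi> f = (SOME v. v \<in> L1 \<and> (\<forall>k. \<phi> k * fourier f k = fourier v k))"

text \<open>The supremum is taken in \<open>ennreal\<close>, so that an upper bound on the operator norm
  includes boundedness of the operator.\<close>

definition L1_op_norm :: "((real \<Rightarrow> complex) \<Rightarrow> real \<Rightarrow> complex) \<Rightarrow> ennreal" where
  "L1_op_norm T = (SUP f\<in>{f \<in> L1. L1_norm f \<le> 1}. ennreal (L1_norm (T f)))"

definition absolutely_continuous_on :: "real set \<Rightarrow> (real \<Rightarrow> complex) \<Rightarrow> bool" where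
  "absolutely_continuous_on S f \<longleftrightarrow>
     (\<forall>\<epsilon>>0. \<exists>\<delta>>0. \<forall>(n::nat) a b.
        (\<forall>i<n. a i \<le> b i \<and> {a i..b i} \<subseteq> S) \<and>
        disjoint_family_on (\<lambda>i. {a i<..<b i}) {..<n} \<and>
        (\<Sum>i<n. b i - a i) < \<delta> \<longrightarrow>
        (\<Sum>i<n. norm (f (b i) - f (a i))) < \<epsilon>)"

definition periodic_2pi :: "(real \<Rightarrow> complex) \<Rightarrow> bool" where
  "periodic_2pi g \<longleftrightarrow> (\<forall>x. g (x + 2 * pi) = g x)"

definition in_Lr :: "real \<Rightarrow> real set \<Rightarrow> (real \<Rightarrow> complex) \<Rightarrow> bool" where
  "in_Lr r S g \<longleftrightarrow> g \<in> borel_measurable (lebesgue_on S) \<and>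
     integrable (lebesgue_on S) (\<lambda>x. norm (g x) powr r)"

definition test_function :: "(real \<Rightarrow> real) \<Rightarrow> bool" where
  "test_function \<phi> \<longleftrightarrow> (\<forall>n x. (deriv ^^ n) \<phi> differentiable (at x)) \<and>
     compact (closure {x. \<phi> x \<noteq> 0})"

definition locally_integrable :: "(real \<Rightarrow> complex) \<Rightarrow> bool" where
  "locally_integrable g \<longleftrightarrow> (\<forall>a b. integrable (lebesgue_on {a..b}) g)"

definition generalized_derivative :: "(real \<Rightarrow> complex) \<Rightarrow> (real \<Rightarrow> complex) \<Rightarrow> bool" where
  "generalized_derivative g h \<longleftrightarrow> locally_integrable g \<and> locally_integrable h \<and>
     (\<forall>\<phi>. test_function \<phi> \<longrightarrow>
        (\<integral>x. g x * of_real (deriv \<phi> x) \<partial>lebesgue) = - (\<integral>x. h x * of_real (\<phi> x) \<partial>lebesgue))"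

definition W1_per :: "real \<Rightarrow> (real \<Rightarrow> complex) set" where
  "W1_per r = {g. periodic_2pi g \<and> in_Lr r {-pi..pi} g \<and>
     (\<exists>h. generalized_derivative g h \<and> in_Lr r {-pi..pi} h)}"

text \<open>Absolute continuity is required on one closed period, hence on every bounded interval. (On all
  of the real line the epsilon-delta condition would be strictly stronger, even for periodic
  functions.) The pointwise derivative of \<open>\<psi>\<close>, which exists almost everywhere by absolute
  continuity, is made explicit in the second bound.\<close>

definition admissible_symbol ::
    "real \<Rightarrow> real \<Rightarrow> real \<Rightarrow> real \<Rightarrow> (real \<Rightarrow> complex) \<Rightarrow> bool" where
  "admissible_symbol \<alpha> c C C' \<psi> \<longleftrightarrow>
     periodic_2pi \<psi> \<and> absolutely_continuous_on {-pi..pi} \<psi> \<and>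
     (AE k in lebesgue_on {-pi..pi}. norm (\<psi> k) \<le> C * \<bar>k\<bar> powr \<alpha>) \<and>
     (AE k in lebesgue_on {-pi..pi}.
        \<exists>d. (\<psi> has_vector_derivative d) (at k) \<and> norm d \<le> C' * \<bar>k\<bar> powr (\<alpha> - 1)) \<and>
     (AE k in lebesgue_on {-pi..pi}. Re (\<psi> k) \<le> - c * \<bar>k\<bar> powr \<alpha>)"

end

theory Submission
  imports Defs "HOL-Probability.Levy"
begin

text \<open>The multipliers \<open>exp (t \<psi>)\<close> and \<open>\<psi> exp (t \<psi>)\<close> are \<open>2\<pi>\<close>-periodic functions of \<open>k\<close>. If such a
  function is the sum of a series \<open>\<Sum>n. a n * exp (i n k)\<close> with \<open>\<Sum>n. norm (a n) < \<infinity>\<close>, then it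
  acts on \<open>L\<^sub>1\<close> as the convolution \<open>f \<mapsto> \<Sum>n. a n * f (x - n)\<close>, whose norm is at most
  \<open>\<Sum>n. norm (a n)\<close> (\<open>L1_multiplier_trigonometric_series\<close>, \<open>L1_multiplier_periodic\<close>). So the
  sum of the absolute values of the Fourier coefficients has to be bounded uniformly in \<open>t\<close>.

  Put \<open>u = t powr (1 / \<alpha>)\<close> and \<open>\<beta> = min \<alpha> (1/4)\<close>. Both \<open>g = exp (t \<psi>)\<close> and
  \<open>g = t \<psi> exp (t \<psi>)\<close> satisfy \<open>norm (g k) \<le> A / (1 + (u k)\<^sup>2)\<close> and
  \<open>norm (g' k) \<le> D * u powr \<beta> * \<bar>k\<bar> powr (\<beta> - 1)\<close>, where \<open>A\<close> and \<open>D\<close> depend only on \<open>\<alpha>\<close>,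
  \<open>c\<close>, \<open>C\<close>, \<open>C'\<close>: the exponential decay absorbs every power of \<open>t * \<bar>k\<bar> powr \<alpha>\<close>. The
  frequencies are now grouped into the dyadic blocks \<open>2 ^ j \<le> \<bar>n\<bar> < 2 ^ (j + 1)\<close>. The
  Cauchy-Schwarz and Bessel inequalities for \<open>g\<close> bound the sum over a block by a multiple of
  \<open>(2 ^ j / u) powr (1/2)\<close> (\<open>low_block_bound\<close>). For large \<open>j\<close> the gain comes from \<open>g'\<close>,
  whose coefficients are \<open>i n\<close> times those of \<open>g\<close>. It is cut at \<open>\<bar>k\<bar> = 1 / 2 ^ j\<close>: near the
  singularity at \<open>0\<close> each coefficient is at most the \<open>L\<^sub>1\<close> norm, and away from it \<open>g'\<close> is
  square integrable and Bessel's inequality applies. Both parts are of the order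
  \<open>(2 ^ j / u) powr (- \<beta>)\<close> (\<open>high_block_bound\<close>). The two geometric estimates cross at
  \<open>2 ^ j = u\<close>, and the sum of their minima is bounded independently of \<open>u\<close>
  (\<open>fcoeff_abs_sum_le\<close>).

  Three general facts support this. The fundamental theorem of calculus holds for absolutely
  continuous functions. The Fourier series of a continuous periodic function that is
  differentiable almost everywhere, if absolutely convergent, sums to the function
  everywhere (\<open>fourier_series_sums\<close>). The Fourier transform is injective on \<open>L\<^sub>1\<close>
  (\<open>fourier_eq_0_imp_AE_0\<close>), so that the function chosen by \<open>multiplier_op\<close> is the
  convolution almost everywhere.

  For the Sobolev statement, the pointwise derivative of \<open>\<psi>\<close> is at most a multiple of
  \<open>\<bar>k\<bar> powr (\<alpha> - 1)\<close>, whose \<open>r\<close>-th power is integrable at \<open>0\<close> if \<open>r * (\<alpha> - 1) > -1\<close>. It is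
  the generalized derivative by the fundamental theorem applied to \<open>\<psi>\<close> times a test
  function, one period after the other.\<close>

section \<open>Absolutely continuous functions\<close>

text \<open>The definition speaks of families indexed by an initial segment of the natural numbers. The
  intervals of a tagged division are indexed by the division itself, which calls for
  arbitrary finite index sets.\<close>

lemma absolutely_continuous_on_finite_family:
  assumes ac: "absolutely_continuous_on S f" and e: "e > 0"
  shows "\<exists>d>0. \<forall>I u v. finite I \<and> (\<forall>i\<in>I. u i \<le> v i \<and> {u i..v i} \<subseteq> S) \<and>
       disjoint_family_on (\<lambda>i. {u i<..<v i}) I \<and> (\<Sum>i\<in>I. v i - u i) < d \<longrightarrow>
       (\<Sum>i\<in>I. norm (f (v i) - f (u i))) < e"
proof -
  obtain d where d: "d > 0" and D: "\<And>(n::nat) a b.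
        (\<forall>i<n. a i \<le> b i \<and> {a i..b i} \<subseteq> S) \<Longrightarrow>
        disjoint_family_on (\<lambda>i. {a i<..<b i}) {..<n} \<Longrightarrow>
        (\<Sum>i<n. b i - a i) < d \<Longrightarrow>
        (\<Sum>i<n. norm (f (b i) - f (a i))) < e"
    using ac e unfolding absolutely_continuous_on_def by meson
  show ?thesis
  proof (intro exI[of _ d] conjI d allI impI; elim conjE)
    fix I :: "'b set" and u v :: "'b \<Rightarrow> real"
    assume I: "finite I" and uv: "\<forall>i\<in>I. u i \<le> v i \<and> {u i..v i} \<subseteq> S"
      and dis: "disjoint_family_on (\<lambda>i. {u i<..<v i}) I" and s: "(\<Sum>i\<in>I. v i - u i) < d"
    obtain h where h: "bij_betw h {..<card I} I"
      using ex_bij_betw_nat_finite[OF I] by (auto simp: atLeast0LessThan)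
    have hI: "h i \<in> I" if "i < card I" for i using h that by (auto simp: bij_betw_def)
    have "(\<Sum>i<card I. norm (f ((v \<circ> h) i) - f ((u \<circ> h) i))) < e"
    proof (rule D)
      show "\<forall>i<card I. (u \<circ> h) i \<le> (v \<circ> h) i \<and> {(u \<circ> h) i..(v \<circ> h) i} \<subseteq> S"
        using uv hI by auto
      show "disjoint_family_on (\<lambda>i. {(u \<circ> h) i<..<(v \<circ> h) i}) {..<card I}"
        unfolding disjoint_family_on_def
      proof (intro ballI impI)
        fix i j assume ij: "i \<in> {..<card I}" "j \<in> {..<card I}" "i \<noteq> j"
        then have "h i \<noteq> h j" using h by (auto simp: bij_betw_def inj_on_def)
        then show "{(u \<circ> h) i<..<(v \<circ> h) i} \<inter> {(u \<circ> h) j<..<(v \<circ> h) j} = {}"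
          using dis hI ij unfolding disjoint_family_on_def o_def by blast
      qed
      show "(\<Sum>i<card I. (v \<circ> h) i - (u \<circ> h) i) < d"
        using s sum.reindex_bij_betw[OF h, of "\<lambda>i. v i - u i"] by simp
    qed
    then show "(\<Sum>i\<in>I. norm (f (v i) - f (u i))) < e"
      using sum.reindex_bij_betw[OF h, of "\<lambda>i. norm (f (v i) - f (u i))"] by simp
  qed
qed

text \<open>The common source of the closure properties below: sums over the intervals are compared term
  by term, so a function whose increments are dominated by those of two absolutely
  continuous functions inherits the property.\<close>

lemma absolutely_continuous_on_dominated:
  assumes f: "absolutely_continuous_on S f" and g: "absolutely_continuous_on S g"
    and L: "\<And>x y. x \<in> S \<Longrightarrow> y \<in> S \<Longrightarrow> norm (h x - h y) \<le> L * (norm (f x - f y) + norm (g x - g y))"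
  shows "absolutely_continuous_on S h"
  unfolding absolutely_continuous_on_def
proof (intro allI impI)
  fix e :: real assume e: "e > 0"
  \<comment> \<open>A positive constant is needed to divide \<open>e\<close>.\<close>
  define L' where "L' = max L 1"
  have L': "L' > 0" "L \<le> L'" by (auto simp: L'_def)
  have e2: "e / (2 * L') > 0" using e L' by simp
  from f e2 obtain d1 where d1: "d1 > 0" and D1: "\<And>(n::nat) a b.
        (\<forall>i<n. a i \<le> b i \<and> {a i..b i} \<subseteq> S) \<Longrightarrow>
        disjoint_family_on (\<lambda>i. {a i<..<b i}) {..<n} \<Longrightarrow>
        (\<Sum>i<n. b i - a i) < d1 \<Longrightarrow>
        (\<Sum>i<n. norm (f (b i) - f (a i))) < e / (2 * L')"
    unfolding absolutely_continuous_on_def by meson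
  from g e2 obtain d2 where d2: "d2 > 0" and D2: "\<And>(n::nat) a b.
        (\<forall>i<n. a i \<le> b i \<and> {a i..b i} \<subseteq> S) \<Longrightarrow>
        disjoint_family_on (\<lambda>i. {a i<..<b i}) {..<n} \<Longrightarrow>
        (\<Sum>i<n. b i - a i) < d2 \<Longrightarrow>
        (\<Sum>i<n. norm (g (b i) - g (a i))) < e / (2 * L')"
    unfolding absolutely_continuous_on_def by meson
  show "\<exists>\<delta>>0. \<forall>(n::nat) a b.
        (\<forall>i<n. a i \<le> b i \<and> {a i..b i} \<subseteq> S) \<and>
        disjoint_family_on (\<lambda>i. {a i<..<b i}) {..<n} \<and>
        (\<Sum>i<n. b i - a i) < \<delta> \<longrightarrow>
        (\<Sum>i<n. norm (h (b i) - h (a i))) < e"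
  proof (intro exI[of _ "min d1 d2"] conjI allI impI, use d1 d2 in simp, elim conjE)
    fix n :: nat and a b :: "nat \<Rightarrow> real"
    assume ab: "\<forall>i<n. a i \<le> b i \<and> {a i..b i} \<subseteq> S"
      and dis: "disjoint_family_on (\<lambda>i. {a i<..<b i}) {..<n}"
      and s: "(\<Sum>i<n. b i - a i) < min d1 d2"
    have "(\<Sum>i<n. norm (h (b i) - h (a i)))
        \<le> (\<Sum>i<n. L' * (norm (f (b i) - f (a i)) + norm (g (b i) - g (a i))))"
    proof (rule sum_mono)
      fix i assume "i \<in> {..<n}"
      then have "a i \<le> b i" "{a i..b i} \<subseteq> S" using ab by auto
      then have "b i \<in> S" "a i \<in> S" by (auto simp: subset_iff)
      then have "norm (h (b i) - h (a i)) \<le> L * (norm (f (b i) - f (a i)) + norm (g (b i) - g (a i)))"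
        by (rule L)
      also have "\<dots> \<le> L' * (norm (f (b i) - f (a i)) + norm (g (b i) - g (a i)))"
        by (intro mult_right_mono) (use L' in auto)
      finally show "norm (h (b i) - h (a i)) \<le> L' * (norm (f (b i) - f (a i)) + norm (g (b i) - g (a i)))" .
    qed
    also have "\<dots> = L' * ((\<Sum>i<n. norm (f (b i) - f (a i))) + (\<Sum>i<n. norm (g (b i) - g (a i))))"
      by (simp add: sum_distrib_left sum.distrib algebra_simps)
    also have "\<dots> < L' * (e / (2 * L') + e / (2 * L'))"
      using D1[OF ab dis] D2[OF ab dis] s L' by (intro mult_strict_left_mono add_strict_mono) auto
    also have "\<dots> = e" using L' by (simp add: field_simps)
    finally show "(\<Sum>i<n. norm (h (b i) - h (a i))) < e" .
  qed
qed

lemma absolutely_continuous_on_Lipschitz: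
  assumes "\<And>x y. x \<in> S \<Longrightarrow> y \<in> S \<Longrightarrow> norm (h x - h y) \<le> L * \<bar>x - y\<bar>"
  shows "absolutely_continuous_on S h"
proof -
  have id: "absolutely_continuous_on S complex_of_real"
    unfolding absolutely_continuous_on_def
  proof (intro allI impI)
    fix e :: real assume "e > 0"
    moreover have "(\<Sum>i<n. norm (complex_of_real (b i) - complex_of_real (a i))) = (\<Sum>i<n. b i - a i)"
      if "\<forall>i<n. a i \<le> b i \<and> {a i..b i} \<subseteq> S" for n :: nat and a b
      using that by (intro sum.cong refl) (simp flip: of_real_diff)
    ultimately show "\<exists>\<delta>>0. \<forall>(n::nat) a b.
        (\<forall>i<n. a i \<le> b i \<and> {a i..b i} \<subseteq> S) \<and>
        disjoint_family_on (\<lambda>i. {a i<..<b i}) {..<n} \<and>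
        (\<Sum>i<n. b i - a i) < \<delta> \<longrightarrow>
        (\<Sum>i<n. norm (complex_of_real (b i) - complex_of_real (a i))) < e"
      by (intro exI[of _ e]) simp
  qed
  show ?thesis
    by (rule absolutely_continuous_on_dominated[OF id id, of _ "L/2"])
       (use assms in \<open>auto simp flip: of_real_diff\<close>)
qed

lemma absolutely_continuous_on_imp_continuous_on:
  assumes ac: "absolutely_continuous_on S f" and S: "is_interval S"
  shows "continuous_on S f"
  unfolding continuous_on_iff
proof (intro ballI allI impI)
  fix x e :: real assume x: "x \<in> S" and e: "e > 0"
  obtain d where d: "d > 0" and D: "\<forall>I u v. finite I \<and> (\<forall>i\<in>I. u i \<le> v i \<and> {u i..v i} \<subseteq> S) \<and>
       disjoint_family_on (\<lambda>i::nat. {u i<..<v i}) I \<and> (\<Sum>i\<in>I. v i - u i) < d \<longrightarrow>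
       (\<Sum>i\<in>I. norm (f (v i) - f (u i))) < e"
    using absolutely_continuous_on_finite_family[OF ac e, where ?'a = nat] by (elim exE conjE) (rule that)
  show "\<exists>d>0. \<forall>x'\<in>S. dist x' x < d \<longrightarrow> dist (f x') (f x) < e"
  proof (intro exI[of _ d] conjI ballI impI d)
    fix y assume y: "y \<in> S" "dist y x < d"
    have "{min x y..max x y} \<subseteq> S"
    proof
      fix z assume "z \<in> {min x y..max x y}"
      then show "z \<in> S"
        using mem_is_interval_1_I[OF S x y(1), of z] mem_is_interval_1_I[OF S y(1) x, of z]
        by (cases "x \<le> y") auto
    qed
    moreover have "min x y \<le> max x y" "max x y - min x y < d"
      using y by (auto simp: dist_real_def)
    ultimately have "(\<Sum>i\<in>{0::nat}. norm (f (max x y) - f (min x y))) < e"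
      using D[rule_format, of "{0}" "\<lambda>_. min x y" "\<lambda>_. max x y"] by (simp add: disjoint_family_on_def)
    then show "dist (f y) (f x) < e"
      by (auto simp: dist_norm min_def max_def norm_minus_commute split: if_splits)
  qed
qed

lemma absolutely_continuous_on_mult:
  assumes f: "absolutely_continuous_on {a..b} f" and g: "absolutely_continuous_on {a..b} g"
  shows "absolutely_continuous_on {a..b} (\<lambda>x. f x * g x)"
proof -
  have "bounded (f ` {a..b})" "bounded (g ` {a..b})"
    by (intro compact_imp_bounded compact_continuous_image
         absolutely_continuous_on_imp_continuous_on f g is_interval_cc compact_Icc)+
  then obtain A B where A: "\<And>x. x \<in> {a..b} \<Longrightarrow> norm (f x) \<le> A" and B: "\<And>x. x \<in> {a..b} \<Longrightarrow> norm (g x) \<le> B"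
    unfolding bounded_iff by (meson imageI)
  show ?thesis
  proof (rule absolutely_continuous_on_dominated[OF f g, of _ "max A B"])
    fix x y assume x: "x \<in> {a..b}" and y: "y \<in> {a..b}"
    have "f x * g x - f y * g y = (f x - f y) * g x + f y * (g x - g y)"
      by (simp add: algebra_simps)
    then have "norm (f x * g x - f y * g y) \<le> norm (f x - f y) * norm (g x) + norm (f y) * norm (g x - g y)"
      by (metis norm_mult norm_triangle_ineq)
    also have "\<dots> \<le> norm (f x - f y) * max A B + max A B * norm (g x - g y)"
      using A[OF y] B[OF x] by (intro add_mono mult_mono) (auto simp: max_def intro: order_trans[OF norm_ge_zero])
    finally show "norm (f x * g x - f y * g y) \<le> max A B * (norm (f x - f y) + norm (g x - g y))"
      by (simp add: algebra_simps)
  qed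
qed

lemma negligible_open_cover:
  assumes "negligible (N :: real set)" and "e > 0"
  obtains U where "open U" "N \<subseteq> U" "U \<in> lmeasurable" "measure lebesgue U < e"
proof -
  have N: "N \<in> sets lebesgue" using assms by (simp add: negligible_iff_null_sets null_setsD2)
  obtain U where U: "open U" "N \<subseteq> U" "U - N \<in> lmeasurable" "emeasure lebesgue (U - N) < ennreal e"
    using sets_lebesgue_outer_open[OF N assms(2)] by metis
  have "U \<in> sets lebesgue" using U(1) by (metis borel_open sets_completionI_sets sets_lborel)
  moreover have "emeasure lebesgue (U - N) = emeasure lebesgue U"
    using assms \<open>U \<in> sets lebesgue\<close> by (simp add: emeasure_Diff_null_set negligible_iff_null_sets)
  ultimately have e: "emeasure lebesgue U < ennreal e" "U \<in> lmeasurable" 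
    using U(4) by (auto simp: fmeasurable_def intro: less_trans)
  then have "measure lebesgue U < e" using assms(2)
    by (simp add: emeasure_eq_measure2 ennreal_less_iff)
  with U e that show ?thesis by blast
qed

text \<open>A gauge argument. At a tag outside the null set the gauge comes from the derivative, and the
  term of the Riemann sum is close to the increment of the function. At a tag in the null
  set it comes from an open cover of small measure: these intervals have small total length,
  so by absolute continuity the increments that the Riemann sum misses there are small.\<close>

theorem fundamental_theorem_of_calculus_absolutely_continuous:
  fixes f :: "real \<Rightarrow> complex"
  assumes "a \<le> b" and ac: "absolutely_continuous_on {a..b} f" and N: "negligible N"
    and vecd: "\<And>x. x \<in> {a..b} - N \<Longrightarrow> (f has_vector_derivative f' x) (at x within {a..b})"
  shows "(f' has_integral (f b - f a)) {a..b}"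
proof (cases "a = b")
  case True then show ?thesis using has_integral_refl(2)[of f' b] by (simp flip: box_real)
next
  case False
  then have ab: "a < b" using assms by simp
  \<comment> \<open>On the null set the integrand may be changed to \<open>0\<close>, so that tags there contribute nothing to Riemann sums.\<close>
  define h where "h x = (if x \<in> N then 0 else f' x)" for x
  have "(h has_integral (f b - f a)) {a..b}"
    unfolding has_integral_factor_content box_real[symmetric]
  proof safe
    fix e :: real
    assume e: "e > 0"
    have e2: "e / 2 > 0" and e2b: "e / 2 * (b - a) > 0" using e ab by auto
    have "\<exists>d>0. x \<in> {a..b} - N \<longrightarrow>
         (\<forall>y\<in>{a..b}. norm (y-x) < d \<longrightarrow> norm (f y - f x - (y-x) *\<^sub>R h x) \<le> e/2 * norm (y-x))" for x
    proof (cases "x \<in> {a..b} - N")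
      case True
      then have "h x = f' x" by (simp add: h_def)
      then show ?thesis
        using vecd[OF True, unfolded has_vector_derivative_def has_derivative_within_alt] e2 by metis
    qed (auto intro: zero_less_one)
    then obtain d where d: "\<And>x. 0 < d x"
                 "\<And>x y. \<lbrakk>x \<in> {a..b} - N; y \<in> {a..b}; norm (y-x) < d x\<rbrakk>
                        \<Longrightarrow> norm (f y - f x - (y-x) *\<^sub>R h x) \<le> e/2 * norm (y-x)"
      by metis
    obtain \<delta> where \<delta>: "\<delta> > 0" and D: "\<forall>I u v. finite I \<and> (\<forall>i\<in>I. u i \<le> v i \<and> {u i..v i} \<subseteq> {a..b}) \<and>
       disjoint_family_on (\<lambda>i::real \<times> real set. {u i<..<v i}) I \<and> (\<Sum>i\<in>I. v i - u i) < \<delta> \<longrightarrow>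
       (\<Sum>i\<in>I. norm (f (v i) - f (u i))) < e / 2 * (b - a)"
      using absolutely_continuous_on_finite_family[OF ac e2b, where ?'a = "real \<times> real set"] by (elim exE conjE) (rule that)
    obtain U where U: "open U" "N \<subseteq> U" "U \<in> lmeasurable" "measure lebesgue U < \<delta>"
      using negligible_open_cover[OF N \<delta>] .
    define \<gamma> where "\<gamma> x = (if x \<in> N then U else ball x (d x))" for x
    show "\<exists>d. gauge d \<and> (\<forall>p. p tagged_division_of (cbox a b) \<and> d fine p \<longrightarrow>
      norm ((\<Sum>(x, k)\<in>p. measure lborel k *\<^sub>R h x) - (f b - f a)) \<le> e * measure lborel (cbox a b))"
    proof (rule exI[of _ \<gamma>], safe)
      show "gauge \<gamma>"
        using d(1) U unfolding gauge_def \<gamma>_def by auto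
    next
      fix p
      assume p: "p tagged_division_of cbox a b" and fine: "\<gamma> fine p"
      define u v :: "real \<times> real set \<Rightarrow> real" where "u z = Inf (snd z)" and "v z = Sup (snd z)" for z
      have fin: "finite p" by (rule tagged_division_ofD(1)[OF p])
      have uv: "K = {u (x,K)..v (x,K)}" "u (x,K) \<le> x" "x \<le> v (x,K)" "{u (x,K)..v (x,K)} \<subseteq> {a..b}"
          "{u (x,K)..v (x,K)} \<subseteq> \<gamma> x" "measure lborel K = v (x,K) - u (x,K)"
        if xK: "(x,K) \<in> p" for x K
      proof -
        have "x \<in> K" and kab: "K \<subseteq> cbox a b"
          using tagged_division_ofD(2,3)[OF p xK] by auto
        obtain r s where k: "K = cbox r s" using tagged_division_ofD(4)[OF p xK] by blast
        then have rs: "r \<le> x" "x \<le> s" using \<open>x \<in> K\<close> by auto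
        then have "u (x,K) = r" "v (x,K) = s" unfolding u_def v_def k by auto
        moreover have "K \<subseteq> \<gamma> x" using fine xK unfolding fine_def by blast
        ultimately show "K = {u (x,K)..v (x,K)}" "u (x,K) \<le> x" "x \<le> v (x,K)" "{u (x,K)..v (x,K)} \<subseteq> {a..b}"
          "{u (x,K)..v (x,K)} \<subseteq> \<gamma> x" "measure lborel K = v (x,K) - u (x,K)"
          using k rs kab by simp_all
      qed
      have p': "p tagged_division_of {a..b}" using p by simp
      have len: "b - a = (\<Sum>z\<in>p. v z - u z)" and tele: "f b - f a = (\<Sum>z\<in>p. f (v z) - f (u z))"
        using additive_tagged_division_1[OF \<open>a \<le> b\<close> p', of "\<lambda>x. x"]
          additive_tagged_division_1[OF \<open>a \<le> b\<close> p', of f]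
        by (simp_all add: u_def v_def case_prod_unfold)
      define P where "P = {z \<in> p. fst z \<in> N}"
      have Pp: "P \<subseteq> p" "finite P" using fin by (auto simp: P_def)
      have dis: "disjoint_family_on (\<lambda>i. {u i<..<v i}) P"
        unfolding disjoint_family_on_def
      proof (intro ballI impI)
        fix y z assume y: "y \<in> P" and z: "z \<in> P" and "y \<noteq> z"
        obtain x K where yy: "y = (x,K)" by (cases y)
        obtain x' K' where zz: "z = (x',K')" by (cases z)
        have in_p: "(x,K) \<in> p" "(x',K') \<in> p" using y z yy zz Pp by auto
        have "interior K \<inter> interior K' = {}"
          using tagged_division_ofD(5)[OF p in_p] \<open>y \<noteq> z\<close> yy zz by simp
        moreover have "{u (x,K)<..<v (x,K)} \<subseteq> interior K" "{u (x',K')<..<v (x',K')} \<subseteq> interior K'"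
          using uv(1)[OF in_p(1)] uv(1)[OF in_p(2)] by (metis interior_atLeastAtMost_real order_refl)+
        ultimately show "{u y<..<v y} \<inter> {u z<..<v z} = {}"
          unfolding yy zz by blast
      qed
      have uvle: "u z \<le> v z \<and> {u z..v z} \<subseteq> {a..b}" if "z \<in> p" for z
        using uv(2-4)[of "fst z" "snd z"] that unfolding prod.collapse by (meson order_trans)
      have "(\<Sum>i\<in>P. v i - u i) = (\<Sum>i\<in>P. measure lebesgue {u i<..<v i})"
        by (intro sum.cong refl) (use uvle Pp in auto)
      also have "\<dots> = measure lebesgue (\<Union>i\<in>P. {u i<..<v i})"
      proof (rule measure_finite_Union[symmetric])
        show "(\<lambda>i. {u i<..<v i}) ` P \<subseteq> sets lebesgue"
          by (metis (no_types, lifting) greaterThanLessThan_borel image_subsetI sets_completionI_sets sets_lborel)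
        show "emeasure lebesgue {u i<..<v i} \<noteq> \<infinity>" for i
            by (cases "u i \<le> v i") auto
      qed (use Pp dis in auto)
      also have "\<dots> \<le> measure lebesgue U"
      proof (rule measure_mono_fmeasurable)
        show "(\<Union>i\<in>P. {u i<..<v i}) \<subseteq> U"
        proof (safe, goal_cases)
          case (1 y x K)
          then have "\<gamma> x = U" "(x,K) \<in> p" by (auto simp: P_def \<gamma>_def)
          then show ?case using 1 uv(5)[of x K] by auto
        qed
        show "(\<Union>i\<in>P. {u i<..<v i}) \<in> sets lebesgue"
          by (intro sets.finite_UN Pp) auto
      qed (rule U)
      finally have small: "(\<Sum>i\<in>P. v i - u i) < \<delta>" using U by simp
      have partN: "(\<Sum>z\<in>P. norm (f (v z) - f (u z))) < e / 2 * (b - a)"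
        using D[rule_format, of P u v] Pp dis small uvle by blast
      have partR: "norm ((case z of (x,K) \<Rightarrow> measure lborel K *\<^sub>R h x) - (f (v z) - f (u z))) \<le> e/2 * (v z - u z)"
        if z: "z \<in> p - P" for z
      proof -
        obtain x K where xK: "z = (x,K)" by (cases z)
        have in_p: "(x,K) \<in> p" and x: "x \<notin> N" using z xK by (auto simp: P_def)
        note * = uv[OF in_p]
        define r s where "r = u z" and "s = v z"
        note rs = r_def[unfolded xK, symmetric] s_def[unfolded xK, symmetric]
        have xab: "x \<in> {a..b} - N" "r \<in> {a..b}" "s \<in> {a..b}" using *(2-4) x unfolding rs by auto
        have "{r..s} \<subseteq> ball x (d x)" "r \<le> s"
          using *(2,3,5) x unfolding \<gamma>_def rs by auto
        then have near: "norm (r - x) < d x" "norm (s - x) < d x"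
          by (auto simp: subset_iff dist_norm norm_minus_commute simp del: real_norm_def)
        have "measure lborel K *\<^sub>R h x - (f s - f r)
          = (f r - f x - (r - x) *\<^sub>R h x) - (f s - f x - (s - x) *\<^sub>R h x)"
          unfolding *(6) rs by (simp add: algebra_simps)
        then have "norm (measure lborel K *\<^sub>R h x - (f s - f r))
          \<le> norm (f r - f x - (r - x) *\<^sub>R h x) + norm (f s - f x - (s - x) *\<^sub>R h x)"
          by (metis norm_triangle_ineq4)
        also have "\<dots> \<le> e/2 * norm (r - x) + e/2 * norm (s - x)"
          by (intro add_mono d(2) xab near)
        also have "\<dots> = e/2 * (s - r)"
        proof -
          have "norm (r - x) + norm (s - x) = s - r" using *(2,3) unfolding rs by simp
          then show ?thesis by (simp flip: distrib_left)
        qed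
        finally show ?thesis unfolding xK r_def s_def by simp
      qed
      have "norm ((\<Sum>(x, k)\<in>p. measure lborel k *\<^sub>R h x) - (f b - f a))
          = norm (\<Sum>z\<in>p. (case z of (x,K) \<Rightarrow> measure lborel K *\<^sub>R h x) - (f (v z) - f (u z)))"
        unfolding tele by (simp add: sum_subtractf)
      also have "\<dots> \<le> (\<Sum>z\<in>p. norm ((case z of (x,K) \<Rightarrow> measure lborel K *\<^sub>R h x) - (f (v z) - f (u z))))"
        by (rule norm_sum)
      also have "\<dots> = (\<Sum>z\<in>p - P. norm ((case z of (x,K) \<Rightarrow> measure lborel K *\<^sub>R h x) - (f (v z) - f (u z))))
          + (\<Sum>z\<in>P. norm ((case z of (x,K) \<Rightarrow> measure lborel K *\<^sub>R h x) - (f (v z) - f (u z))))"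
        by (rule sum.subset_diff[OF Pp(1) fin])
      also have "(\<Sum>z\<in>P. norm ((case z of (x,K) \<Rightarrow> measure lborel K *\<^sub>R h x) - (f (v z) - f (u z))))
          = (\<Sum>z\<in>P. norm (f (v z) - f (u z)))"
        by (intro sum.cong refl) (auto simp: P_def h_def norm_minus_commute)
      also have "(\<Sum>z\<in>p - P. norm ((case z of (x,K) \<Rightarrow> measure lborel K *\<^sub>R h x) - (f (v z) - f (u z))))
          \<le> (\<Sum>z\<in>p - P. e/2 * (v z - u z))"
        by (rule sum_mono) (rule partR)
      also have "\<dots> \<le> (\<Sum>z\<in>p. e/2 * (v z - u z))"
        by (rule sum_mono2) (use fin e uvle in auto)
      also have "\<dots> = e/2 * (b - a)" unfolding len by (simp add: sum_distrib_left)
      also note partN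
      finally show "norm ((\<Sum>(x, k)\<in>p. measure lborel k *\<^sub>R h x) - (f b - f a)) \<le> e * measure lborel (cbox a b)"
        using ab by simp
    qed
  qed
  then show ?thesis
    by (rule has_integral_spike[OF N, rotated]) (auto simp: h_def)
qed

section \<open>Fourier coefficients on one period\<close>

text \<open>A circle is cut open at \<open>\<plusminus>\<pi>\<close>, so that the only singularity of a symbol, \<open>k = 0\<close>, is an
  interior point.\<close>

abbreviation torus :: "real measure" where "torus \<equiv> lebesgue_on {-pi..pi}"

text \<open>Without the usual factor \<open>1 / (2 * pi)\<close>, which reappears where the series is summed.\<close>

definition fcoeff :: "(real \<Rightarrow> complex) \<Rightarrow> int \<Rightarrow> complex" where
  "fcoeff f n = (\<integral>k. f k * cis (- (of_int n * k)) \<partial>torus)"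

lemma finite_measure_torus: "finite_measure torus"
  by (intro finite_measureI) (simp add: emeasure_restrict_space)

lemma cis_measurable_torus [measurable]: "(\<lambda>k. cis (a * k)) \<in> borel_measurable torus"
  by (intro continuous_imp_measurable_on_sets_lebesgue) (auto intro!: continuous_intros)

lemma integrable_torus_bounded:
  fixes f :: "real \<Rightarrow> 'a::{banach, second_countable_topology}"
  assumes "f \<in> borel_measurable torus" "\<And>k. k \<in> {-pi..pi} \<Longrightarrow> norm (f k) \<le> B"
  shows "integrable torus f"
  using assms by (intro finite_measure.integrable_const_bound[OF finite_measure_torus, of _ B])
    (auto simp: AE_restrict_space_iff intro!: always_eventually)

lemma integrable_torus_mult_cis:
  assumes "integrable torus f"
  shows "integrable torus (\<lambda>k. f k * cis (a * k))"
  by (rule Bochner_Integration.integrable_bound[OF assms]) (use assms in \<open>auto simp: norm_mult\<close>)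

lemma has_vector_derivative_cis:
  "((\<lambda>k. cis (a * k)) has_vector_derivative (\<i> * of_real a * cis (a * k))) (at k within S)"
proof -
  have "((\<lambda>z. exp (\<i> * of_real a * z)) has_field_derivative \<i> * of_real a * exp (\<i> * of_real a * of_real k))
      (at (of_real k))"
    by (auto intro!: derivative_eq_intros)
  from has_vector_derivative_real_field[OF this] show ?thesis
    by (simp add: cis_conv_exp mult.assoc)
qed

lemma integral_torus_cis:
  "(\<integral>k. cis (of_int m * k) \<partial>torus) = (if m = 0 then of_real (2 * pi) else 0)"
proof (cases "m = 0")
  case True then show ?thesis by (simp add: measure_restrict_space scaleR_conv_of_real)
next
  case False
  have int: "integrable torus (\<lambda>k. cis (of_int m * k))"
    by (rule integrable_torus_bounded[of _ 1]) auto
  have "((\<lambda>k. cis (of_int m * k)) has_integral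
      (cis (of_int m * pi) / (\<i> * of_int m) - cis (of_int m * (-pi)) / (\<i> * of_int m))) {-pi..pi}"
  proof (rule fundamental_theorem_of_calculus)
    fix k :: real
    have "((\<lambda>k. cis (of_int m * k) / (\<i> * of_int m)) has_vector_derivative cis (of_int m * k)) (at k)"
      using has_vector_derivative_divide[OF has_vector_derivative_cis[of "of_int m" k UNIV], of "\<i> * of_int m"] False
      by simp
    then show "((\<lambda>k. cis (of_int m * k) / (\<i> * of_int m)) has_vector_derivative cis (of_int m * k)) (at k within {-pi..pi})"
      by (rule has_vector_derivative_at_within)
  qed simp
  moreover have "cis (of_int m * pi) = cis (of_int m * (-pi))"
    by (simp add: complex_eq_iff sin_times_pi_eq_0)
  ultimately have "((\<lambda>k. cis (of_int m * k)) has_integral 0) {-pi..pi}" by simp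
  then show ?thesis
    using False lebesgue_integral_eq_integral[OF int] by (simp add: integral_unique)
qed

lemma fcoeff_add:
  assumes "integrable torus f" "integrable torus g"
  shows "fcoeff (\<lambda>k. f k + g k) n = fcoeff f n + fcoeff g n"
  using integrable_torus_mult_cis[OF assms(1), of "- of_int n"] integrable_torus_mult_cis[OF assms(2), of "- of_int n"]
  unfolding fcoeff_def by (simp add: distrib_right)

lemma norm_fcoeff_le: "norm (fcoeff f n) \<le> (\<integral>k. norm (f k) \<partial>torus)"
  unfolding fcoeff_def by (rule order_trans[OF integral_norm_bound]) (simp add: norm_mult)

text \<open>The square integral of the difference between \<open>f\<close> and its partial Fourier sum is
  nonnegative.\<close>

lemma bessel_inequality:
  assumes f [measurable]: "f \<in> borel_measurable torus" and B: "\<And>k. k \<in> {-pi..pi} \<Longrightarrow> norm (f k) \<le> B"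
    and F: "finite F"
  shows "(\<Sum>n\<in>F. (norm (fcoeff f n))\<^sup>2) \<le> 2 * pi * (\<integral>k. (norm (f k))\<^sup>2 \<partial>torus)"
proof -
  define c where "c n = fcoeff f n / (2 * pi)" for n
  define S where "S k = (\<Sum>n\<in>F. c n * cis (of_int n * k))" for k
  define Q where "Q = (\<Sum>n\<in>F. (norm (c n))\<^sup>2)"
  have intf: "integrable torus f" by (rule integrable_torus_bounded[OF f B])
  have intcf: "integrable torus (\<lambda>k. cnj (f k))" using intf by simp
  have int1: "integrable torus (\<lambda>k. f k * cis (a * k))" for a
    by (rule integrable_torus_mult_cis[OF intf])
  have cnjS: "cnj (S k) = (\<Sum>n\<in>F. cnj (c n) * cis (- (of_int n) * k))" for k
    unfolding S_def by (simp add: cis_cnj)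
  have fS: "f k * cnj (S k) = (\<Sum>n\<in>F. cnj (c n) * (f k * cis (- of_int n * k)))" for k
    unfolding cnjS by (simp add: sum_distrib_left mult_ac)
  have SS: "S k * cnj (S k) = (\<Sum>n\<in>F. \<Sum>m\<in>F. c n * cnj (c m) * cis (of_int (n - m) * k))" for k
  proof -
    have e: "cis (of_int (n - m) * k) = cis (of_int n * k) * cis (- of_int m * k)" for n m
      by (simp add: cis_mult algebra_simps)
    show ?thesis unfolding cnjS e unfolding S_def by (simp add: sum_product mult_ac)
  qed
  have int3: "integrable torus (\<lambda>k. cis (of_int m * k))" for m
    by (rule integrable_torus_bounded[of _ 1]) auto
  have i1: "integrable torus (\<lambda>k. f k * cnj (S k))"
    unfolding fS by (intro Bochner_Integration.integrable_sum integrable_mult_right int1)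
  have v1: "(\<integral>k. f k * cnj (S k) \<partial>torus) = of_real (2 * pi * Q)"
  proof -
    have "(\<integral>k. f k * cnj (S k) \<partial>torus) = (\<Sum>n\<in>F. cnj (c n) * (\<integral>k. f k * cis (- of_int n * k) \<partial>torus))"
      unfolding fS
      by (subst Bochner_Integration.integral_sum)
         (auto intro!: integrable_mult_right int1[of "- of_int _", simplified])
    also have "\<dots> = (\<Sum>n\<in>F. of_real (2 * pi * (norm (c n))\<^sup>2))"
    proof (rule sum.cong[OF refl])
      fix n
      have "(\<integral>k. f k * cis (- of_int n * k) \<partial>torus) = of_real (2 * pi) * c n"
        by (simp add: c_def fcoeff_def)
      then show "cnj (c n) * (\<integral>k. f k * cis (- of_int n * k) \<partial>torus) = of_real (2 * pi * (norm (c n))\<^sup>2)"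
        by (simp add: complex_norm_square[symmetric, unfolded of_real_power] mult_ac)
    qed
    finally show ?thesis by (simp add: Q_def sum_distrib_left)
  qed
  have i2: "integrable torus (\<lambda>k. S k * cnj (S k))"
    unfolding SS by (intro Bochner_Integration.integrable_sum integrable_mult_right int3)
  have v2: "(\<integral>k. S k * cnj (S k) \<partial>torus) = of_real (2 * pi * Q)"
  proof -
    have "(\<integral>k. S k * cnj (S k) \<partial>torus)
        = (\<Sum>n\<in>F. \<Sum>m\<in>F. c n * cnj (c m) * (\<integral>k. cis (of_int (n - m) * k) \<partial>torus))"
      unfolding SS
      by (subst Bochner_Integration.integral_sum,
          (intro Bochner_Integration.integrable_sum integrable_mult_right int3),
          intro sum.cong refl, subst Bochner_Integration.integral_sum,
          (intro integrable_mult_right int3), simp)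
    also have "\<dots> = (\<Sum>n\<in>F. \<Sum>m\<in>F. if m = n then c n * cnj (c n) * of_real (2 * pi) else 0)"
      unfolding integral_torus_cis by (intro sum.cong refl) auto
    also have "\<dots> = (\<Sum>n\<in>F. c n * cnj (c n) * of_real (2 * pi))"
      using F by (intro sum.cong refl) (simp add: sum.delta)
    also have "\<dots> = of_real (2 * pi * Q)"
      by (simp add: Q_def sum_distrib_left complex_norm_square[symmetric, unfolded of_real_power] mult_ac)
    finally show ?thesis .
  qed
  have i0: "integrable torus (\<lambda>k. (norm (f k))\<^sup>2)"
    by (rule integrable_torus_bounded[of _ "B\<^sup>2"]) (auto intro!: power_mono B)
  have lin: "(\<integral>k. u k - 2 * v k + w k \<partial>torus) = (\<integral>k. u k \<partial>torus) - 2 * (\<integral>k. v k \<partial>torus) + (\<integral>k. w k \<partial>torus)"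
    if "integrable torus u" "integrable torus v" "integrable torus w" for u v w :: "real \<Rightarrow> real"
    using that by simp
  have "0 \<le> (\<integral>k. (norm (f k - S k))\<^sup>2 \<partial>torus)" by simp
  also have "(\<lambda>k. (norm (f k - S k))\<^sup>2)
      = (\<lambda>k. (norm (f k))\<^sup>2 - 2 * Re (f k * cnj (S k)) + Re (S k * cnj (S k)))"
    by (simp add: fun_eq_iff cmod_power2) (simp add: power2_eq_square algebra_simps)
  also have "(\<integral>k. (norm (f k))\<^sup>2 - 2 * Re (f k * cnj (S k)) + Re (S k * cnj (S k)) \<partial>torus)
      = (\<integral>k. (norm (f k))\<^sup>2 \<partial>torus) - 2 * (\<integral>k. Re (f k * cnj (S k)) \<partial>torus) + (\<integral>k. Re (S k * cnj (S k)) \<partial>torus)"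
    by (rule lin[OF i0 integrable_Re[OF i1] integrable_Re[OF i2]])
  also have "\<dots> = (\<integral>k. (norm (f k))\<^sup>2 \<partial>torus) - 2 * pi * Q"
    unfolding integral_Re[OF i1] integral_Re[OF i2] v1 v2 by simp
  finally have "2 * pi * Q \<le> (\<integral>k. (norm (f k))\<^sup>2 \<partial>torus)" by simp
  then have "2 * pi * (2 * pi * Q) \<le> 2 * pi * (\<integral>k. (norm (f k))\<^sup>2 \<partial>torus)"
    by (intro mult_left_mono) auto
  moreover have "(\<Sum>n\<in>F. (norm (fcoeff f n))\<^sup>2) = 2 * pi * (2 * pi * Q)"
  proof -
    have "(norm (fcoeff f n))\<^sup>2 = 2 * pi * (2 * pi * (norm (c n))\<^sup>2)" for n
    proof -
      have "norm (fcoeff f n) = 2 * pi * norm (c n)" by (simp add: c_def norm_divide norm_mult)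
      then show ?thesis by (simp add: power_mult_distrib power2_eq_square)
    qed
    then show ?thesis unfolding Q_def by (simp only: sum_distrib_left)
  qed
  ultimately show ?thesis by simp
qed

corollary fcoeff_sum_le_L2:
  assumes f: "f \<in> borel_measurable torus" and B: "\<And>k. k \<in> {-pi..pi} \<Longrightarrow> norm (f k) \<le> B"
    and F: "finite F"
  shows "(\<Sum>n\<in>F. norm (fcoeff f n)) \<le> sqrt (of_nat (card F) * (2 * pi * (\<integral>k. (norm (f k))\<^sup>2 \<partial>torus)))"
proof (rule real_le_rsqrt)
  have "(\<Sum>n\<in>F. norm (fcoeff f n))\<^sup>2 \<le> of_nat (card F) * (\<Sum>n\<in>F. (norm (fcoeff f n))\<^sup>2)"
    using sum_squared_le_sum_of_squares[of "\<lambda>n. norm (fcoeff f n)" F] by (simp add: mult.commute)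
  also have "\<dots> \<le> of_nat (card F) * (2 * pi * (\<integral>k. (norm (f k))\<^sup>2 \<partial>torus))"
    by (intro mult_left_mono bessel_inequality[OF f B F]) auto
  finally show "(\<Sum>n\<in>F. norm (fcoeff f n))\<^sup>2 \<le> of_nat (card F) * (2 * pi * (\<integral>k. (norm (f k))\<^sup>2 \<partial>torus))" .
qed

corollary fcoeff_tendsto_0:
  assumes f: "f \<in> borel_measurable torus" and B: "\<And>k. k \<in> {-pi..pi} \<Longrightarrow> norm (f k) \<le> B"
    and g: "inj (g :: nat \<Rightarrow> int)"
  shows "(\<lambda>N. fcoeff f (g N)) \<longlonglongrightarrow> 0"
proof -
  have "summable (\<lambda>N. (norm (fcoeff f (g N)))\<^sup>2)"
  proof (rule summableI_nonneg_bounded)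
    fix N
    have "(\<Sum>i<N. (norm (fcoeff f (g i)))\<^sup>2) = (\<Sum>n\<in>g ` {..<N}. (norm (fcoeff f n))\<^sup>2)"
      using g by (subst sum.reindex) (auto intro: inj_on_subset)
    also have "\<dots> \<le> 2 * pi * (\<integral>k. (norm (f k))\<^sup>2 \<partial>torus)"
      by (intro bessel_inequality[OF f B]) auto
    finally show "(\<Sum>i<N. (norm (fcoeff f (g i)))\<^sup>2) \<le> 2 * pi * (\<integral>k. (norm (f k))\<^sup>2 \<partial>torus)" .
  qed auto
  then have "(\<lambda>N. (norm (fcoeff f (g N)))\<^sup>2) \<longlonglongrightarrow> 0"
    by (rule summable_LIMSEQ_zero)
  then have "(\<lambda>N. norm (fcoeff f (g N))) \<longlonglongrightarrow> 0"
    by (rule power_tendsto_0_iff[THEN iffD1, rotated]) auto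
  then show ?thesis by (rule tendsto_norm_zero_cancel)
qed

lemma cis_eq_imp_eq:
  assumes "cis x = cis y" "\<bar>x - y\<bar> < 2 * pi" shows "x = y"
proof -
  have "sin x = sin y" "cos x = cos y" using assms(1) by (simp_all add: complex_eq_iff)
  then obtain n :: int where n: "x = y + 2 * pi * n" using sin_cos_eq_iff by blast
  then have "\<bar>2 * pi * of_int n\<bar> < 2 * pi" using assms(2) by simp
  then have "\<bar>real_of_int n\<bar> < 1" by (simp add: abs_mult)
  then show ?thesis using n by simp
qed

lemma difference_quotient_tendsto:
  fixes f :: "real \<Rightarrow> complex"
  assumes "(f has_vector_derivative d) (at x)"
  shows "((\<lambda>k. (f k - f x) / complex_of_real (k - x)) \<longlongrightarrow> d) (at x)"
proof -
  have "((\<lambda>y. norm (f y - f x - (y - x) *\<^sub>R d) / norm (y - x)) \<longlongrightarrow> 0) (at x)"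
    using assms unfolding has_vector_derivative_def has_derivative_iff_norm by blast
  moreover have "\<forall>\<^sub>F y in at x. norm (f y - f x - (y - x) *\<^sub>R d) / norm (y - x)
      = norm ((f y - f x) / complex_of_real (y - x) - d)"
  proof -
    have "norm (f y - f x - (y - x) *\<^sub>R d) / norm (y - x)
      = norm ((f y - f x) / complex_of_real (y - x) - d)" if "y \<noteq> x" for y
    proof -
      have "(f y - f x) / complex_of_real (y - x) - d = (f y - f x - (y - x) *\<^sub>R d) / complex_of_real (y - x)"
        using that by (simp add: diff_divide_distrib scaleR_conv_of_real flip: of_real_diff)
      then show ?thesis by (simp add: norm_divide flip: of_real_diff)
    qed
    then show ?thesis by (auto simp: eventually_at intro!: exI[of _ 1])
  qed
  ultimately have "((\<lambda>y. norm ((f y - f x) / complex_of_real (y - x) - d)) \<longlongrightarrow> 0) (at x)"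
    by (subst (asm) tendsto_cong)
  then show ?thesis by (rule LIM_zero_cancel[OF tendsto_norm_zero_cancel])
qed

text \<open>Chernoff's argument. The quotient \<open>q k = (f k - f x) / (cis k - cis x)\<close> extends continuously
  to \<open>x\<close>, because \<open>f\<close> is differentiable there. From \<open>f k = f x + (cis k - cis x) * q k\<close> the
  coefficients of \<open>f\<close> are differences of consecutive coefficients of \<open>q\<close>, so the partial sum
  at \<open>x\<close> telescopes, and the two remaining coefficients of \<open>q\<close> tend to \<open>0\<close> by Bessel's
  inequality.\<close>

lemma symmetric_partial_sums_tendsto:
  assumes f: "continuous_on {-pi..pi} f" and x: "x \<in> {-pi<..<pi}"
    and d: "(f has_vector_derivative d) (at x)"
  shows "(\<lambda>N. \<Sum>n\<in>{- int N..int N}. fcoeff f n * cis (of_int n * x)) \<longlonglongrightarrow> of_real (2 * pi) * f x"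
proof -
  define q where "q k = (if k = x then d / (\<i> * cis x) else (f k - f x) / (cis k - cis x))" for k
  have cisne: "cis k - cis x \<noteq> 0" if "k \<in> {-pi..pi}" "k \<noteq> x" for k
  proof -
    have "\<bar>k - x\<bar> < 2 * pi" using that x by (auto simp: abs_less_iff)
    then show ?thesis using cis_eq_imp_eq[of k x] that by auto
  qed
  have contq: "continuous_on {-pi..pi} q"
    unfolding continuous_on_eq_continuous_within
  proof
    fix y assume y: "y \<in> {-pi..pi}"
    show "continuous (at y within {-pi..pi}) q"
    proof (cases "y = x")
      case True
      have 1: "((\<lambda>k. (f k - f x) / complex_of_real (k - x)) \<longlongrightarrow> d) (at x)"
        by (rule difference_quotient_tendsto[OF d])
      have 2: "((\<lambda>k. (cis k - cis x) / complex_of_real (k - x)) \<longlongrightarrow> \<i> * cis x) (at x)"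
        using difference_quotient_tendsto[OF has_vector_derivative_cis[of 1 x UNIV]] by simp
      have "((\<lambda>k. ((f k - f x) / complex_of_real (k - x)) / ((cis k - cis x) / complex_of_real (k - x))) \<longlongrightarrow> d / (\<i> * cis x)) (at x)"
        by (intro tendsto_divide 1 2) auto
      moreover have "\<forall>\<^sub>F k in at x. ((f k - f x) / complex_of_real (k - x)) / ((cis k - cis x) / complex_of_real (k - x)) = q k"
        by (auto simp: eventually_at q_def intro!: exI[of _ 1])
      ultimately have "(q \<longlongrightarrow> q x) (at x)"
        by (subst (asm) tendsto_cong) (auto simp: q_def)
      then show ?thesis
        unfolding True continuous_within by (rule filterlim_mono) (auto simp: at_le)
    next
      case False
      have ev: "\<forall>\<^sub>F k in at y within {-pi..pi}. (f k - f x) / (cis k - cis x) = q k"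
        using False unfolding eventually_at
        by (intro exI[of _ "dist x y"]) (auto simp: q_def dist_commute)
      have "((\<lambda>k. (f k - f x) / (cis k - cis x)) \<longlongrightarrow> (f y - f x) / (cis y - cis x)) (at y within {-pi..pi})"
      proof (intro tendsto_divide tendsto_diff tendsto_const)
        show "(f \<longlongrightarrow> f y) (at y within {-pi..pi})" using f y by (simp add: continuous_on_def)
        have "continuous_on {-pi..pi} cis" by (intro continuous_intros)
        then show "(cis \<longlongrightarrow> cis y) (at y within {-pi..pi})" using y by (simp add: continuous_on_def)
      qed (rule cisne[OF y False])
      then have "(q \<longlongrightarrow> (f y - f x) / (cis y - cis x)) (at y within {-pi..pi})"
        by (subst (asm) tendsto_cong[OF ev])
      then show ?thesis using False by (simp add: continuous_within q_def)
    qed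
  qed
  have "bounded (q ` {-pi..pi})"
    by (intro compact_imp_bounded compact_continuous_image contq compact_Icc)
  then obtain B where B: "\<And>k. k \<in> {-pi..pi} \<Longrightarrow> norm (q k) \<le> B" unfolding bounded_iff by (meson imageI)
  have qm: "q \<in> borel_measurable torus"
    by (intro continuous_imp_measurable_on_sets_lebesgue contq) auto
  have qi: "integrable torus q" by (rule integrable_torus_bounded[OF qm B])
  have feq: "f k = f x + (cis k - cis x) * q k" if "k \<in> {-pi..pi}" for k
    using cisne[OF that] by (auto simp: q_def)
  have coeff: "fcoeff f n = (if n = 0 then of_real (2 * pi) * f x else 0) + fcoeff q (n - 1) - cis x * fcoeff q n" for n
  proof -
    have eq: "f k * cis (- (of_int n * k))
        = f x * cis (of_int (-n) * k) + q k * cis (- of_int (n - 1) * k) - cis x * (q k * cis (- of_int n * k))"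
      if "k \<in> {-pi..pi}" for k
    proof -
      have "cis k * cis (- (of_int n * k)) = cis (- of_int (n - 1) * k)"
        by (simp add: cis_mult algebra_simps)
      then show ?thesis unfolding feq[OF that] by (simp add: algebra_simps)
    qed
    have ints: "integrable torus (\<lambda>k. f x * cis (of_int (-n) * k))"
       "integrable torus (\<lambda>k. q k * cis (- of_int (n - 1) * k))"
       "integrable torus (\<lambda>k. cis x * (q k * cis (- of_int n * k)))"
      by (rule integrable_mult_right, rule integrable_torus_bounded[of _ 1], rule cis_measurable_torus, simp)
         (rule integrable_torus_mult_cis[OF qi], rule integrable_mult_right, rule integrable_torus_mult_cis[OF qi])
    have "fcoeff f n = (\<integral>k. f x * cis (of_int (-n) * k) + q k * cis (- of_int (n - 1) * k) - cis x * (q k * cis (- of_int n * k)) \<partial>torus)"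
      unfolding fcoeff_def by (rule Bochner_Integration.integral_cong) (use eq in auto)
    also have "\<dots> = (\<integral>k. f x * cis (of_int (-n) * k) \<partial>torus) + (\<integral>k. q k * cis (- of_int (n - 1) * k) \<partial>torus)
         - (\<integral>k. cis x * (q k * cis (- of_int n * k)) \<partial>torus)"
      by (subst Bochner_Integration.integral_diff, intro Bochner_Integration.integrable_add ints, rule ints,
          subst Bochner_Integration.integral_add, rule ints, rule ints, rule refl)
    also have "\<dots> = (if n = 0 then of_real (2 * pi) * f x else 0) + fcoeff q (n - 1) - cis x * fcoeff q n"
      unfolding fcoeff_def integral_mult_right_zero integral_torus_cis by (simp add: algebra_simps)
    finally show ?thesis .
  qed
  define T where "T n = fcoeff q n * cis (of_int (n + 1) * x)" for n
  have summand: "fcoeff f n * cis (of_int n * x) = (if n = 0 then of_real (2 * pi) * f x else 0) + (T (n - 1) - T n)" for n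
  proof -
    have "cis (of_int n * x) * cis x = cis (of_int (n + 1) * x)" by (simp add: cis_mult algebra_simps)
    then show ?thesis unfolding coeff T_def by (simp add: algebra_simps)
  qed
  have tele: "(\<Sum>n\<in>{- int N..int N}. T (n - 1) - T n) = T (- int N - 1) - T (int N)" for N
  proof (induction N)
    case (Suc N)
    have "{- int (Suc N)..int (Suc N)} = insert (- int N - 1) (insert (int N + 1) {- int N..int N})" by auto
    then show ?case using Suc by (simp add: algebra_simps)
  qed simp
  have sum: "(\<Sum>n\<in>{- int N..int N}. fcoeff f n * cis (of_int n * x)) = of_real (2 * pi) * f x + (T (- int N - 1) - T (int N))" for N
    unfolding summand sum.distrib tele by (simp add: sum.delta)
  have T0: "(\<lambda>N. T (g N)) \<longlonglongrightarrow> 0" if "inj (g :: nat \<Rightarrow> int)" for g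
  proof (rule tendsto_norm_zero_cancel)
    show "(\<lambda>N. norm (T (g N))) \<longlonglongrightarrow> 0"
      using tendsto_norm_zero[OF fcoeff_tendsto_0[OF qm B that]] by (simp add: T_def norm_mult)
  qed
  have "(\<lambda>N. of_real (2 * pi) * f x + (T (- int N - 1) - T (int N))) \<longlonglongrightarrow> of_real (2 * pi) * f x + (0 - 0)"
    by (intro tendsto_intros T0) (auto intro: injI)
  then show ?thesis unfolding sum by simp
qed

section \<open>Absolutely convergent Fourier series\<close>

lemma AE_lebesgue_on_negligible:
  assumes "AE k in lebesgue_on S. P k" "S \<in> sets lebesgue"
  shows "negligible {k \<in> S. \<not> P k}"
proof -
  have "AE k in lebesgue. k \<in> S \<longrightarrow> P k"
    using assms by (simp add: AE_restrict_space_iff)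
  from this[unfolded eventually_ae_filter]
  obtain N where N: "N \<in> null_sets lebesgue" "{k \<in> space lebesgue. \<not> (k \<in> S \<longrightarrow> P k)} \<subseteq> N"
    by (elim bexE)
  from N(2) have "{k \<in> S. \<not> P k} \<subseteq> N" by (simp add: subset_iff)
  with N(1) show ?thesis by (metis negligible_iff_null_sets negligible_subset)
qed

lemma continuous_on_AE_le_imp_le:
  fixes F G :: "real \<Rightarrow> real"
  assumes F: "continuous_on {a..b} F" and G: "continuous_on {a..b} G" and ab: "a < b"
    and ae: "AE k in lebesgue_on {a..b}. F k \<le> G k" and x: "x \<in> {a..b}"
  shows "F x \<le> G x"
proof (rule ccontr)
  assume "\<not> F x \<le> G x"
  then have pos: "F x - G x > 0" by simp
  have "continuous_on {a..b} (\<lambda>k. F k - G k)" using F G by (rule continuous_on_diff)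
  then obtain d where d: "d > 0" and D: "\<And>k. k \<in> {a..b} \<Longrightarrow> dist k x < d \<Longrightarrow> dist (F k - G k) (F x - G x) < F x - G x"
    using x pos unfolding continuous_on_iff by blast
  let ?U = "{max a (x - d)<..<min b (x + d)}"
  have "?U \<subseteq> {k \<in> {a..b}. \<not> F k \<le> G k}"
  proof
    fix k assume k: "k \<in> ?U"
    then have "dist (F k - G k) (F x - G x) < F x - G x" by (intro D) (auto simp: dist_real_def)
    then have "F k - G k > 0" unfolding dist_real_def by arith
    then show "k \<in> {k \<in> {a..b}. \<not> F k \<le> G k}" using k by auto
  qed
  moreover have "negligible {k \<in> {a..b}. \<not> F k \<le> G k}"
    by (rule AE_lebesgue_on_negligible[OF ae]) auto
  ultimately have negU: "negligible ?U" by (rule negligible_subset[rotated])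
  moreover have "max a (x - d) < min b (x + d)" using x d ab by auto
  then have "?U \<noteq> {}" by (simp only: greaterThanLessThan_empty_iff not_le not_False_eq_True)
  ultimately show False using open_not_negligible[OF open_greaterThanLessThan, of "max a (x - d)" "min b (x + d)"] by blast
qed

lemma continuous_on_AE_eq_imp_eq:
  fixes f g :: "real \<Rightarrow> complex"
  assumes "continuous_on {a..b} f" "continuous_on {a..b} g" "a < b"
    and "AE k in lebesgue_on {a..b}. f k = g k" "x \<in> {a..b}"
  shows "f x = g x"
proof -
  have "norm (f x - g x) \<le> 0"
  proof (rule continuous_on_AE_le_imp_le[of a b "\<lambda>k. norm (f k - g k)" "\<lambda>_. 0"])
    show "AE k in lebesgue_on {a..b}. norm (f k - g k) \<le> 0" using assms(4) by auto
  qed (intro continuous_intros assms | simp)+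
  then show ?thesis by simp
qed

lemma periodic_2pi_shift:
  assumes "periodic_2pi f"
  shows "f (x + 2 * pi * of_int n) = f x"
proof -
  have nat: "f (x + 2 * pi * of_nat m) = f x" for x and m :: nat
  proof (induction m)
    case (Suc m)
    have "f (x + 2 * pi * of_nat (Suc m)) = f ((x + 2 * pi * of_nat m) + 2 * pi)"
      by (simp add: algebra_simps)
    then show ?case using Suc assms unfolding periodic_2pi_def by simp
  qed simp
  show ?thesis
  proof (cases "n \<ge> 0")
    case True
    then show ?thesis using nat[of x "nat n"] by simp
  next
    case False
    then show ?thesis using nat[of "x + 2 * pi * of_int n" "nat (- n)"] by simp
  qed
qed

lemma reduce_mod_2pi:
  obtains n :: int where "x + 2 * pi * of_int n \<in> {-pi..pi}"
proof -
  define n where "n = - \<lfloor>(x + pi) / (2 * pi)\<rfloor>"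
  have "real_of_int (-n) \<le> (x + pi) / (2 * pi)" "(x + pi) / (2 * pi) < real_of_int (-n) + 1"
    unfolding n_def by linarith+
  then have "x + 2 * pi * of_int n \<in> {-pi..pi}"
    by (auto simp: field_simps)
  then show ?thesis by (rule that)
qed

lemma filterlim_symmetric_int_intervals:
  "filterlim (\<lambda>N. {- int N..int N}) (finite_subsets_at_top UNIV) sequentially"
  unfolding filterlim_finite_subsets_at_top
proof (intro allI impI)
  fix X :: "int set" assume X: "finite X \<and> X \<subseteq> UNIV"
  define m where "m = Max (insert 0 ((nat \<circ> abs) ` X))"
  have "nat \<bar>n\<bar> \<le> m" if "n \<in> X" for n
    unfolding m_def using X that by (intro Max_ge) auto
  then have "X \<subseteq> {- int N..int N}" if "N \<ge> m" for N
    using that by force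
  then show "\<forall>\<^sub>F N in sequentially. finite {- int N..int N} \<and> X \<subseteq> {- int N..int N} \<and> {- int N..int N} \<subseteq> UNIV"
    unfolding eventually_sequentially by (intro exI[of _ m]) auto
qed

text \<open>The sum of the series is continuous by uniform convergence. It agrees with \<open>f\<close> at the points
  of differentiability, which are almost all points, hence everywhere. The enumeration
  \<open>int_decode\<close> of the integers turns the series into one over the natural numbers.\<close>

theorem fourier_series_sums:
  assumes cont: "continuous_on UNIV f" and per: "periodic_2pi f"
    and diff: "AE k in torus. \<exists>d. (f has_vector_derivative d) (at k)"
    and summ: "summable (\<lambda>j. norm (fcoeff f (int_decode j)))"
  shows "(\<lambda>j. fcoeff f (int_decode j) * cis (of_int (int_decode j) * x)) sums (of_real (2 * pi) * f x)"
proof -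
  define u where "u j k = fcoeff f (int_decode j) * cis (of_int (int_decode j) * k)" for j k
  define S where "S k = (\<Sum>j. u j k)" for k
  have nu: "norm (u j k) = norm (fcoeff f (int_decode j))" for j k by (simp add: u_def norm_mult)
  have un: "summable (\<lambda>j. norm (u j k))" for k unfolding nu by (rule summ)
  have sums: "(\<lambda>j. u j k) sums S k" for k
    unfolding S_def by (rule summable_sums[OF summable_norm_cancel[OF un]])
  have "uniform_limit UNIV (\<lambda>n k. \<Sum>j<n. u j k) S sequentially"
    unfolding S_def by (rule Weierstrass_m_test[OF _ summ]) (simp add: nu)
  then have contS: "continuous_on UNIV S"
    by (rule uniform_limit_theorem[rotated])
       (auto simp: u_def intro!: always_eventually continuous_intros)
  have at_diff: "S k = of_real (2 * pi) * f k"
    if k: "k \<in> {-pi<..<pi}" and d: "(f has_vector_derivative d) (at k)" for k d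
  proof -
    have "((\<lambda>j. u j k) has_sum S k) UNIV"
      by (rule norm_summable_imp_has_sum[OF un sums])
    then have "((\<lambda>n. fcoeff f n * cis (of_int n * k)) has_sum S k) UNIV"
      unfolding u_def
      using has_sum_reindex_bij_betw[OF bij_int_decode, of "\<lambda>n. fcoeff f n * cis (of_int n * k)"] by simp
    then have "(\<lambda>N. \<Sum>n\<in>{- int N..int N}. fcoeff f n * cis (of_int n * k)) \<longlonglongrightarrow> S k"
      unfolding has_sum_def by (rule filterlim_compose[OF _ filterlim_symmetric_int_intervals])
    moreover have "(\<lambda>N. \<Sum>n\<in>{- int N..int N}. fcoeff f n * cis (of_int n * k)) \<longlonglongrightarrow> of_real (2 * pi) * f k"
      by (rule symmetric_partial_sums_tendsto[OF continuous_on_subset[OF cont] k d]) simp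
    ultimately show ?thesis by (rule LIMSEQ_unique)
  qed
  have "AE k in torus. k \<noteq> a" for a
    using AE_lborel_singleton[of a]
    by (auto simp: AE_restrict_space_iff intro!: AE_completion elim: eventually_mono)
  from this[of pi] this[of "-pi"] have "AE k in torus. S k = of_real (2 * pi) * f k"
    using diff AE_space
  proof eventually_elim
    case (elim k)
    then have "k \<in> {-pi<..<pi}" by auto
    with elim at_diff show ?case by blast
  qed
  then have eq: "S k = of_real (2 * pi) * f k" if "k \<in> {-pi..pi}" for k
    using that
    by (rule continuous_on_AE_eq_imp_eq[rotated 3])
       (auto intro!: continuous_intros continuous_on_subset[OF cont] continuous_on_subset[OF contS])
  obtain n where n: "x + 2 * pi * of_int n \<in> {-pi..pi}" by (rule reduce_mod_2pi)
  have "u j (x + 2 * pi * of_int n) = u j x" for j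
  proof -
    have "cis (of_int (int_decode j) * (x + 2 * pi * of_int n)) = cis (of_int (int_decode j) * x) * cis (2 * pi * of_int (int_decode j * n))"
      by (simp add: cis_mult algebra_simps)
    then show ?thesis by (simp add: u_def)
  qed
  then have "S x = S (x + 2 * pi * of_int n)" by (simp add: S_def)
  also have "\<dots> = of_real (2 * pi) * f x" using eq[OF n] periodic_2pi_shift[OF per] by simp
  finally show ?thesis using sums[of x] by (simp add: u_def)
qed

section \<open>Dyadic blocks of frequencies\<close>

lemma has_integral_even_extension:
  fixes w :: "real \<Rightarrow> real"
  assumes "(w has_integral I) {0..a}" "a \<ge> 0"
  shows "((\<lambda>k. w \<bar>k\<bar>) has_integral (2 * I)) {-a..a}"
proof -
  have 1: "((\<lambda>k. w \<bar>k\<bar>) has_integral I) {0..a}"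
    by (rule has_integral_eq[OF _ assms(1)]) auto
  have "((\<lambda>k. w \<bar>-k\<bar>) has_integral I) {-a..-0}"
    unfolding has_integral_reflect_real[where f="\<lambda>k. w \<bar>k\<bar>"] by (rule 1)
  then have 2: "((\<lambda>k. w \<bar>k\<bar>) has_integral I) {-a..0}" by simp
  from has_integral_combine[OF _ _ 2 1] show ?thesis using assms(2) by simp
qed

text \<open>Reduces estimates on the period to integrals over \<open>[0, \<pi>]\<close>, where the bounds below have
  explicit primitives.\<close>

lemma torus_integral_le_even:
  fixes f w :: "real \<Rightarrow> real"
  assumes w: "(w has_integral I) {0..pi}" and w0: "\<And>k. k \<in> {0..pi} \<Longrightarrow> 0 \<le> w k"
    and f: "f \<in> borel_measurable torus" and le: "\<And>k. k \<in> {-pi..pi} \<Longrightarrow> \<bar>f k\<bar> \<le> w \<bar>k\<bar>"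
  shows "integrable torus f" "(\<integral>k. f k \<partial>torus) \<le> 2 * I"
proof -
  have hi: "((\<lambda>k. w \<bar>k\<bar>) has_integral (2 * I)) {-pi..pi}"
    by (rule has_integral_even_extension[OF w]) simp
  have "(\<lambda>k. w \<bar>k\<bar>) absolutely_integrable_on {-pi..pi}"
    by (rule nonnegative_absolutely_integrable_1) (use hi in \<open>auto simp: integrable_on_def intro!: w0\<close>)
  then have int: "integrable torus (\<lambda>k. w \<bar>k\<bar>)"
    by (rule absolutely_integrable_imp_integrable) auto
  show i: "integrable torus f"
    by (rule Bochner_Integration.integrable_bound[OF int f])
       (auto intro!: AE_I2 order_trans[OF le])
  have "(\<integral>k. f k \<partial>torus) \<le> (\<integral>k. w \<bar>k\<bar> \<partial>torus)"
    by (rule integral_mono[OF i int]) (use le in \<open>force simp: abs_le_iff\<close>)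
  also have "\<dots> = 2 * I"
    using lebesgue_integral_eq_integral[OF int] hi by (simp add: integral_unique)
  finally show "(\<integral>k. f k \<partial>torus) \<le> 2 * I" .
qed

text \<open>The bound does not depend on where the geometric sequence crosses \<open>1\<close>: up to a constant,
  \<open>min z (1 / z)\<close> is at most \<open>z / (1 + z)\<^sup>2\<close>, and this is at most a multiple of the decrease
  of \<open>1 / (1 + z)\<close> between \<open>z\<close> and \<open>z * \<rho>\<close>, so the sum telescopes.\<close>

lemma sum_min_geometric_le:
  fixes \<rho> y :: real
  assumes "\<rho> > 1" "y > 0"
  shows "(\<Sum>j<J. min (y * \<rho> ^ j) (1 / (y * \<rho> ^ j))) \<le> 4 * \<rho> / (\<rho> - 1)"
proof -
  have step: "min z (1 / z) \<le> 4 * \<rho> / (\<rho> - 1) * (1 / (1 + z) - 1 / (1 + z * \<rho>))" if z: "z > 0" for z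
  proof -
    have "min z (1 / z) \<le> 4 * z / (1 + z)\<^sup>2"
    proof (cases "z \<le> 1")
      case True
      then have "(1 + z)\<^sup>2 \<le> 2\<^sup>2" using z by (intro power_mono) auto
      then have "z * (1 + z)\<^sup>2 \<le> z * 4" using z by (intro mult_left_mono) auto
      then have "z \<le> 4 * z / (1 + z)\<^sup>2" using z by (simp add: field_simps)
      then show ?thesis by simp
    next
      case False
      then have "(1 + z)\<^sup>2 \<le> (2 * z)\<^sup>2" using z by (intro power_mono) auto
      then have "(1 + z)\<^sup>2 \<le> 4 * z * z" by (simp add: power2_eq_square)
      then have "1 / z \<le> 4 * z / (1 + z)\<^sup>2" using z by (simp add: divide_simps mult_ac)
      then show ?thesis by simp
    qed
    also have "\<dots> = 4 * \<rho> / (\<rho> - 1) * ((\<rho> - 1) * z / ((1 + z) * (\<rho> * (1 + z))))"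
      using assms z by (simp add: power2_eq_square)
    also have "\<dots> \<le> 4 * \<rho> / (\<rho> - 1) * ((\<rho> - 1) * z / ((1 + z) * (1 + z * \<rho>)))"
      using assms z by (intro mult_left_mono divide_left_mono mult_pos_pos)
        (auto simp: algebra_simps add_pos_pos)
    also have "(\<rho> - 1) * z / ((1 + z) * (1 + z * \<rho>)) = 1 / (1 + z) - 1 / (1 + z * \<rho>)"
    proof -
      have "1 + z \<noteq> 0" "1 + z * \<rho> \<noteq> 0" using assms z by (auto simp: add_pos_pos less_imp_neq[symmetric])
      then show ?thesis by (simp add: diff_frac_eq algebra_simps)
    qed
    finally show ?thesis .
  qed
  define \<phi> where "\<phi> j = 1 / (1 + y * \<rho> ^ j)" for j
  have "(\<Sum>j<J. min (y * \<rho> ^ j) (1 / (y * \<rho> ^ j))) \<le> (\<Sum>j<J. 4 * \<rho> / (\<rho> - 1) * (\<phi> j - \<phi> (Suc j)))"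
  proof (rule sum_mono)
    fix j
    show "min (y * \<rho> ^ j) (1 / (y * \<rho> ^ j)) \<le> 4 * \<rho> / (\<rho> - 1) * (\<phi> j - \<phi> (Suc j))"
      using step[of "y * \<rho> ^ j"] assms by (simp add: \<phi>_def mult_ac)
  qed
  also have "\<dots> = 4 * \<rho> / (\<rho> - 1) * (\<phi> 0 - \<phi> J)"
    by (simp only: sum_distrib_left[symmetric] sum_lessThan_telescope')
  also have "\<dots> \<le> 4 * \<rho> / (\<rho> - 1) * 1"
  proof (rule mult_left_mono)
    have "\<phi> 0 \<le> 1" using assms by (simp add: \<phi>_def)
    moreover have "\<phi> J \<ge> 0" using assms by (simp add: \<phi>_def)
    ultimately show "\<phi> 0 - \<phi> J \<le> 1" by simp
  qed (use assms in auto)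
  finally show ?thesis by simp
qed

definition dyadic_block :: "nat \<Rightarrow> int set" where
  "dyadic_block j = {n. 2 ^ j \<le> \<bar>n\<bar> \<and> \<bar>n\<bar> < 2 ^ Suc j}"

lemma finite_dyadic_block: "finite (dyadic_block j)"
  by (rule finite_subset[of _ "{- (2 ^ Suc j)..2 ^ Suc j}"]) (auto simp: dyadic_block_def)

lemma card_dyadic_block: "card (dyadic_block j) \<le> 2 * 2 ^ j"
proof -
  have "dyadic_block j \<subseteq> {2 ^ j..<2 ^ Suc j} \<union> {- (2 ^ Suc j)<..- (2 ^ j)}"
    by (auto simp: dyadic_block_def)
  then have "card (dyadic_block j) \<le> card ({2 ^ j..<2 ^ Suc j} \<union> {- (2 ^ Suc j)<..- (2 ^ j) :: int})"
    by (intro card_mono) auto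
  also have "\<dots> \<le> card {2 ^ j..<2 ^ Suc j :: int} + card {- (2 ^ Suc j)<..- (2 ^ j) :: int}"
    by (rule card_Un_le)
  also have "\<dots> = 2 * 2 ^ j" by (simp add: nat_power_eq)
  finally show ?thesis .
qed

lemma disjoint_dyadic_blocks:
  assumes "i \<noteq> j" shows "dyadic_block i \<inter> dyadic_block j = {}"
proof -
  have "dyadic_block i \<inter> dyadic_block j = {}" if "i < j" for i j
  proof -
    have "(2::int) ^ Suc i \<le> 2 ^ j" using that by (intro power_increasing) auto
    then show ?thesis by (auto simp: dyadic_block_def)
  qed
  then show ?thesis using assms by (metis Int_commute linorder_neqE_nat)
qed

lemma finite_int_subset_dyadic:
  assumes "finite (F :: int set)"
  obtains J where "F \<subseteq> insert 0 (\<Union>j<J. dyadic_block j)"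
proof -
  have "\<exists>j. n = 0 \<or> n \<in> dyadic_block j" for n
  proof (cases "n = 0")
    case False
    then have "nat \<bar>n\<bar> \<ge> 1" by simp
    from ex_power_ivl1[OF order_refl this] obtain j where j: "2 ^ j \<le> nat \<bar>n\<bar>" "nat \<bar>n\<bar> < 2 ^ (j + 1)" by auto
    from j have "int (2 ^ j) \<le> \<bar>n\<bar>" "\<bar>n\<bar> < int (2 ^ (j + 1))" by linarith+
    then show ?thesis by (intro exI[of _ j]) (simp add: dyadic_block_def)
  qed simp
  then obtain m where m: "\<And>n. n = 0 \<or> n \<in> dyadic_block (m n)" by metis
  show ?thesis
  proof (rule that[of "Suc (Max (insert 0 (m ` F)))"])
    show "F \<subseteq> insert 0 (\<Union>j<Suc (Max (insert 0 (m ` F))). dyadic_block j)"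
    proof
      fix n assume n: "n \<in> F"
      then have "m n \<le> Max (insert 0 (m ` F))" using assms by (intro Max_ge) auto
      then show "n \<in> insert 0 (\<Union>j<Suc (Max (insert 0 (m ` F))). dyadic_block j)"
        using m[of n] by auto
    qed
  qed
qed

text \<open>Integration by parts; the boundary terms cancel by periodicity.\<close>

lemma fcoeff_derivative:
  assumes ac: "absolutely_continuous_on {-pi..pi} g" and per: "g pi = g (-pi)"
    and N: "negligible N"
    and d: "\<And>k. k \<in> {-pi..pi} - N \<Longrightarrow> (g has_vector_derivative h k) (at k)"
    and h: "integrable torus h"
  shows "fcoeff h n = \<i> * of_int n * fcoeff g n"
proof -
  have ac_cis: "absolutely_continuous_on {-pi..pi} (\<lambda>k. cis (- of_int n * k))"
  proof (rule absolutely_continuous_on_Lipschitz[of _ _ "\<bar>real_of_int n\<bar>"])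
    fix x y
    have "norm (cis (- of_int n * x) - cis (- of_int n * y)) \<le> \<bar>real_of_int n\<bar> * norm (x - y)"
    proof (rule differentiable_bound[of UNIV "\<lambda>k. cis (- of_int n * k)" "\<lambda>k t. t *\<^sub>R (\<i> * of_real (- of_int n) * cis (- of_int n * k))"])
      fix k :: real
      show "((\<lambda>k. cis (- of_int n * k)) has_derivative (\<lambda>t. t *\<^sub>R (\<i> * of_real (- of_int n) * cis (- of_int n * k)))) (at k within UNIV)"
        using has_vector_derivative_cis[of "- of_int n" k UNIV] unfolding has_vector_derivative_def .
      show "onorm (\<lambda>t. t *\<^sub>R (\<i> * of_real (- of_int n) * cis (- of_int n * k))) \<le> \<bar>real_of_int n\<bar>"
        by (rule onorm_le) (simp add: norm_mult)
    qed auto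
    then show "norm (cis (- of_int n * x) - cis (- of_int n * y)) \<le> \<bar>real_of_int n\<bar> * \<bar>x - y\<bar>"
      by simp
  qed
  let ?D = "\<lambda>k. g k * (\<i> * of_real (- of_int n) * cis (- of_int n * k)) + h k * cis (- of_int n * k)"
  have "(?D has_integral (g pi * cis (- of_int n * pi) - g (-pi) * cis (- of_int n * (-pi)))) {-pi..pi}"
  proof (rule fundamental_theorem_of_calculus_absolutely_continuous[OF _ absolutely_continuous_on_mult[OF ac ac_cis] N])
    fix k assume "k \<in> {-pi..pi} - N"
    from d[OF this]
    show "((\<lambda>k. g k * cis (- of_int n * k)) has_vector_derivative ?D k) (at k within {-pi..pi})"
      by (intro has_vector_derivative_mult has_vector_derivative_cis) (rule has_vector_derivative_at_within)
  qed simp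
  moreover have "cis (- of_int n * pi) = cis (- of_int n * (-pi))"
    by (simp add: complex_eq_iff sin_times_pi_eq_0)
  ultimately have D: "(?D has_integral 0) {-pi..pi}" using per by simp
  have gi: "integrable torus g"
    by (intro continuous_imp_integrable_real absolutely_continuous_on_imp_continuous_on[OF ac]) auto
  have i1: "integrable torus (\<lambda>k. g k * cis (- (of_int n) * k))" and i2: "integrable torus (\<lambda>k. h k * cis (- (of_int n) * k))"
    by (intro integrable_torus_mult_cis gi h)+
  have Deq: "?D k = - \<i> * of_int n * (g k * cis (- of_int n * k)) + h k * cis (- of_int n * k)" for k
    by (simp add: algebra_simps)
  have iD: "integrable torus ?D"
    unfolding Deq by (intro Bochner_Integration.integrable_add integrable_mult_right i1 i2)
  have "0 = (\<integral>k. ?D k \<partial>torus)"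
    using lebesgue_integral_eq_integral[OF iD] D by (simp add: integral_unique)
  also have "\<dots> = - \<i> * of_int n * (\<integral>k. g k * cis (- of_int n * k) \<partial>torus) + (\<integral>k. h k * cis (- of_int n * k) \<partial>torus)"
    unfolding Deq using i1 i2 by (subst Bochner_Integration.integral_add) auto
  finally have "(\<integral>k. h k * cis (- of_int n * k) \<partial>torus) = \<i> * of_int n * (\<integral>k. g k * cis (- of_int n * k) \<partial>torus)"
    by (simp add: algebra_simps eq_neg_iff_add_eq_0)
  then show ?thesis unfolding fcoeff_def by simp
qed

text \<open>The square integral of \<open>1 / (1 + (u k)\<^sup>2)\<close> is at most of the order \<open>1 / u\<close>, and a block has
  at most \<open>2 * 2 ^ j\<close> elements.\<close>

lemma low_block_bound:
  assumes g: "continuous_on {-pi..pi} g" and u: "u > 0" and A: "A \<ge> 0"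
    and gA: "\<And>k. k \<in> {-pi..pi} \<Longrightarrow> norm (g k) \<le> A / (1 + (u * k)\<^sup>2)"
  shows "(\<Sum>n\<in>dyadic_block j. norm (fcoeff g n)) \<le> 2 * pi * A * sqrt (2 ^ j / u)"
proof -
  have gm: "g \<in> borel_measurable torus"
    by (intro continuous_imp_measurable_on_sets_lebesgue g) auto
  have [measurable]: "g \<in> borel_measurable torus" by (rule gm)
  have le1: "A / (1 + (u * k)\<^sup>2) \<le> A" for k
    using A by (simp add: divide_le_eq mult_le_cancel_left1 add_pos_nonneg) 
  have gB: "norm (g k) \<le> A" if "k \<in> {-pi..pi}" for k
    using gA[OF that] le1[of k] by simp
  have "((\<lambda>k. A\<^sup>2 / (1 + (u * k)\<^sup>2)) has_integral (A\<^sup>2 * (arctan (u * pi) / u) - A\<^sup>2 * (arctan (u * 0) / u))) {0..pi}"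
  proof (rule fundamental_theorem_of_calculus)
    fix k assume "k \<in> {0..pi}"
    have "1 + (u * k)\<^sup>2 \<noteq> 0" by (smt (verit) zero_le_power2)
    then show "((\<lambda>k. A\<^sup>2 * (arctan (u * k) / u)) has_vector_derivative A\<^sup>2 / (1 + (u * k)\<^sup>2)) (at k within {0..pi})"
      unfolding has_real_derivative_iff_has_vector_derivative[symmetric]
      using u by (auto intro!: derivative_eq_intros simp: divide_simps)
  qed simp
  then have hi: "((\<lambda>k. A\<^sup>2 / (1 + (u * k)\<^sup>2)) has_integral (A\<^sup>2 * (arctan (u * pi) / u))) {0..pi}" by simp
  have "(\<integral>k. (norm (g k))\<^sup>2 \<partial>torus) \<le> 2 * (A\<^sup>2 * (arctan (u * pi) / u))"
  proof (rule torus_integral_le_even(2)[OF hi])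
    fix k assume "k \<in> {-pi..pi}"
    then have "(norm (g k))\<^sup>2 \<le> norm (g k) * A"
      unfolding power2_eq_square using gB by (intro mult_left_mono) auto
    also have "\<dots> \<le> A / (1 + (u * k)\<^sup>2) * A"
      by (intro mult_right_mono gA A \<open>k \<in> {-pi..pi}\<close>)
    finally show "\<bar>(norm (g k))\<^sup>2\<bar> \<le> A\<^sup>2 / (1 + (u * \<bar>k\<bar>)\<^sup>2)"
      by (simp add: power2_eq_square[of A] power2_eq_square[of "norm _"] power_mult_distrib)
  qed auto
  also have "\<dots> \<le> 2 * (A\<^sup>2 * ((pi / 2) / u))"
    using u arctan_ubound[of "u * pi"] by (intro mult_left_mono divide_right_mono) auto
  finally have L2: "(\<integral>k. (norm (g k))\<^sup>2 \<partial>torus) \<le> A\<^sup>2 * pi / u" by simp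
  have "(\<Sum>n\<in>dyadic_block j. norm (fcoeff g n))
      \<le> sqrt (of_nat (card (dyadic_block j)) * (2 * pi * (\<integral>k. (norm (g k))\<^sup>2 \<partial>torus)))"
    by (rule fcoeff_sum_le_L2[OF gm gB finite_dyadic_block])
  also have "\<dots> \<le> sqrt ((2 * 2 ^ j) * (2 * pi * (A\<^sup>2 * pi / u)))"
  proof (intro real_sqrt_le_mono mult_mono L2 order_refl)
    show "real (card (dyadic_block j)) \<le> 2 * 2 ^ j"
      using of_nat_mono[OF card_dyadic_block[of j], where 'a = real] by simp
  qed (use u in auto)
  also have "(2 * 2 ^ j) * (2 * pi * (A\<^sup>2 * pi / u)) = (2 * pi * A)\<^sup>2 * (2 ^ j / u)"
    by (simp add: power2_eq_square)
  also have "sqrt \<dots> = 2 * pi * A * sqrt (2 ^ j / u)"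
    using A by (simp only: real_sqrt_mult real_sqrt_abs) simp
  finally show ?thesis .
qed

lemma has_integral_powr_inside:
  assumes "\<beta> > 0" "0 < s" "s \<le> pi"
  shows "((\<lambda>k. if k \<in> {0..s} then D * k powr (\<beta> - 1) else 0) has_integral D * (s powr \<beta> / \<beta>)) {0..pi}"
proof -
  have "((\<lambda>k. D * k powr (\<beta> - 1)) has_integral D * (s powr \<beta> / \<beta>)) {0..s}"
    using has_integral_mult_right[OF has_integral_powr_from_0[of "\<beta> - 1" s], of D] assms by simp
  then show ?thesis using assms by (subst has_integral_restrict) auto
qed

lemma has_integral_powr_outside:
  assumes "a < - 1" "0 < s" "s \<le> pi"
  shows "((\<lambda>k. if k \<in> {s..pi} then D * k powr a else 0) has_integral
      D * ((pi powr (a + 1) - s powr (a + 1)) / (a + 1))) {0..pi}"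
proof -
  have "((\<lambda>k. D * k powr a) has_integral
      (D * (pi powr (a + 1) / (a + 1)) - D * (s powr (a + 1) / (a + 1)))) {s..pi}"
  proof (rule fundamental_theorem_of_calculus)
    fix k assume "k \<in> {s..pi}"
    then show "((\<lambda>k. D * (k powr (a + 1) / (a + 1))) has_vector_derivative D * k powr a) (at k within {s..pi})"
      unfolding has_real_derivative_iff_has_vector_derivative[symmetric]
      using assms by (auto intro!: derivative_eq_intros)
  qed (use assms in simp)
  then have "((\<lambda>k. D * k powr a) has_integral D * ((pi powr (a + 1) - s powr (a + 1)) / (a + 1))) {s..pi}"
    by (simp add: diff_divide_distrib right_diff_distrib)
  then show ?thesis using assms by (subst has_integral_restrict) auto
qed

text \<open>With \<open>s = 1 / 2 ^ j\<close>, the function \<open>h\<close>, in the role of the derivative of \<open>g\<close>, is cut at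
  \<open>\<bar>k\<bar> = s\<close>. The inner part has \<open>L\<^sub>1\<close> norm of the order \<open>s powr \<beta>\<close>, which bounds each of the
  at most \<open>2 / s\<close> coefficients. The outer part has a square integral of the order
  \<open>s powr (2 * \<beta> - 1)\<close>, since \<open>\<beta> \<le> 1/4\<close> makes \<open>\<bar>k\<bar> powr (2 * \<beta> - 2)\<close> decay faster than
  \<open>1 / \<bar>k\<bar>\<close>. Both parts sum to the order \<open>s powr \<beta> / s\<close> over the block, and dividing by
  \<open>\<bar>n\<bar> \<ge> 1 / s\<close> gives \<open>s powr \<beta>\<close>.\<close>

lemma high_block_bound:
  assumes h: "h \<in> borel_measurable torus" and D: "D \<ge> 0" and \<beta>: "0 < \<beta>" "\<beta> \<le> 1/4"
    and hD: "\<And>k. k \<in> {-pi..pi} \<Longrightarrow> norm (h k) \<le> D * \<bar>k\<bar> powr (\<beta> - 1)"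
    and hg: "\<And>n. norm (fcoeff h n) = \<bar>of_int n\<bar> * norm (fcoeff g n)"
  shows "(\<Sum>n\<in>dyadic_block j. norm (fcoeff g n)) \<le> (4 / \<beta> + 8) * D * (1 / 2 ^ j) powr \<beta>"
proof -
  define s :: real where "s = 1 / 2 ^ j"
  have s: "0 < s" "s \<le> 1" "s \<le> pi" using pi_ge_two by (auto simp: s_def intro: order_trans[of _ 1])
  have sj: "2 ^ j = 1 / s" by (simp add: s_def)
  define h1 h2 where "h1 k = (if \<bar>k\<bar> \<le> s then h k else 0)" and "h2 k = (if \<bar>k\<bar> \<le> s then 0 else h k)" for k
  have [measurable]: "h \<in> borel_measurable torus" by (rule h)
  have [measurable]: "(\<lambda>k::real. k) \<in> borel_measurable torus"
    by (intro continuous_imp_measurable_on_sets_lebesgue) auto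
  have h1m: "h1 \<in> borel_measurable torus" and h2m: "h2 \<in> borel_measurable torus"
    unfolding h1_def h2_def by measurable
  have [measurable]: "h1 \<in> borel_measurable torus" "h2 \<in> borel_measurable torus" by (fact h1m h2m)+
  note W1 = has_integral_powr_inside[OF \<beta>(1) s(1,3), of D]
  have h1n: "integrable torus (\<lambda>k. norm (h1 k))" "(\<integral>k. norm (h1 k) \<partial>torus) \<le> 2 * (D * (s powr \<beta> / \<beta>))"
    by (rule torus_integral_le_even[OF W1]; use D hD in \<open>force simp: h1_def\<close>)+
  have h1i: "integrable torus h1" using h1n(1) by (subst integrable_norm_iff[symmetric]) auto
  have h2B: "norm (h2 k) \<le> D * s powr (\<beta> - 1)" if k: "k \<in> {-pi..pi}" for k
  proof (cases "\<bar>k\<bar> \<le> s")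
    case True then show ?thesis using D by (simp add: h2_def)
  next
    case False
    then have "\<bar>k\<bar> powr (\<beta> - 1) \<le> s powr (\<beta> - 1)" using s \<beta> by (intro powr_mono2') auto
    then show ?thesis using hD[OF k] False D by (auto simp: h2_def intro: order_trans mult_left_mono)
  qed
  have h2i: "integrable torus h2" by (rule integrable_torus_bounded[OF h2m h2B])
  have a: "2 * \<beta> - 2 < - 1" using \<beta> by simp
  note W2 = has_integral_powr_outside[OF a s(1,3), of "D\<^sup>2"]
  have "(\<integral>k. (norm (h2 k))\<^sup>2 \<partial>torus)
      \<le> 2 * (D\<^sup>2 * ((pi powr (2 * \<beta> - 2 + 1) - s powr (2 * \<beta> - 2 + 1)) / (2 * \<beta> - 2 + 1)))"
  proof (rule torus_integral_le_even(2)[OF W2])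
    fix k assume k: "k \<in> {-pi..pi}"
    show "\<bar>(norm (h2 k))\<^sup>2\<bar> \<le> (if \<bar>k\<bar> \<in> {s..pi} then D\<^sup>2 * \<bar>k\<bar> powr (2 * \<beta> - 2) else 0)"
    proof (cases "\<bar>k\<bar> \<le> s")
      case False
      have "(norm (h k))\<^sup>2 \<le> (D * \<bar>k\<bar> powr (\<beta> - 1))\<^sup>2" by (intro power_mono hD k) auto
      also have "\<dots> = D\<^sup>2 * \<bar>k\<bar> powr (2 * \<beta> - 2)"
        by (simp add: power_mult_distrib power2_eq_square[of "_ powr _"] flip: powr_add)
      finally show ?thesis using False k by (auto simp: h2_def)
    qed (simp add: h2_def)
  qed auto
  also have "\<dots> = 2 * D\<^sup>2 * ((s powr (2 * \<beta> - 1) - pi powr (2 * \<beta> - 1)) / (1 - 2 * \<beta>))"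
  proof -
    have "(x - y) / (2 * \<beta> - 1) = (y - x) / (1 - 2 * \<beta>)" for x y :: real
      by (metis minus_diff_eq minus_divide_divide)
    then show ?thesis by simp
  qed
  also have "\<dots> \<le> 2 * D\<^sup>2 * (s powr (2 * \<beta> - 1) / (1/2))"
    using \<beta> by (intro mult_left_mono frac_le) auto
  finally have h2L2: "(\<integral>k. (norm (h2 k))\<^sup>2 \<partial>torus) \<le> 4 * D\<^sup>2 * s powr (2 * \<beta> - 1)" by simp
  have card: "real (card (dyadic_block j)) \<le> 2 / s"
    using card_dyadic_block[of j] unfolding s_def
    by (simp add: of_nat_le_iff[symmetric, where 'a=real] del: of_nat_le_iff)
  have sum1: "(\<Sum>n\<in>dyadic_block j. norm (fcoeff h1 n)) \<le> 2 / s * (2 * (D * (s powr \<beta> / \<beta>)))"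
  proof -
    have "(\<Sum>n\<in>dyadic_block j. norm (fcoeff h1 n)) \<le> of_nat (card (dyadic_block j)) * (2 * (D * (s powr \<beta> / \<beta>)))"
      by (rule sum_bounded_above) (rule order_trans[OF norm_fcoeff_le h1n(2)])
    also have "\<dots> \<le> 2 / s * (2 * (D * (s powr \<beta> / \<beta>)))"
      using D \<beta> by (intro mult_right_mono card) auto
    finally show ?thesis .
  qed
  have sum2: "(\<Sum>n\<in>dyadic_block j. norm (fcoeff h2 n)) \<le> 8 * D * s powr \<beta> / s"
  proof -
    have "(\<Sum>n\<in>dyadic_block j. norm (fcoeff h2 n))
        \<le> sqrt (of_nat (card (dyadic_block j)) * (2 * pi * (\<integral>k. (norm (h2 k))\<^sup>2 \<partial>torus)))"
      by (rule fcoeff_sum_le_L2[OF h2m h2B finite_dyadic_block])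
    also have "\<dots> \<le> sqrt ((2 / s) * ((2 * 4) * (4 * D\<^sup>2 * s powr (2 * \<beta> - 1))))"
      using card h2L2 s pi_less_4 by (intro real_sqrt_le_mono mult_mono) auto
    also have "(2 / s) * ((2 * 4) * (4 * D\<^sup>2 * s powr (2 * \<beta> - 1))) = (8 * D * s powr \<beta> / s)\<^sup>2"
    proof -
      have "s powr (2 * \<beta> - 1) = (s powr \<beta>)\<^sup>2 / s"
        using s by (simp add: powr_diff power2_eq_square flip: powr_add)
      then show ?thesis by (simp add: power2_eq_square)
    qed
    also have "sqrt \<dots> = 8 * D * s powr \<beta> / s" using D s by simp
    finally show ?thesis .
  qed
  have "h k = h1 k + h2 k" for k by (simp add: h1_def h2_def)
  then have "h = (\<lambda>k. h1 k + h2 k)" by auto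
  then have split: "fcoeff h n = fcoeff h1 n + fcoeff h2 n" for n
    using fcoeff_add[OF h1i h2i] by simp
  have "(\<Sum>n\<in>dyadic_block j. norm (fcoeff g n)) \<le> (\<Sum>n\<in>dyadic_block j. s * (norm (fcoeff h1 n) + norm (fcoeff h2 n)))"
  proof (rule sum_mono)
    fix n assume "n \<in> dyadic_block j"
    then have "2 ^ j \<le> \<bar>n\<bar>" by (simp add: dyadic_block_def)
    then have "(2 ^ j :: real) \<le> \<bar>of_int n\<bar>" by (metis of_int_abs of_int_le_iff of_int_numeral of_int_power)
    then have "1 \<le> s * \<bar>of_int n\<bar>" by (simp add: s_def)
    then have "norm (fcoeff g n) \<le> (s * \<bar>of_int n\<bar>) * norm (fcoeff g n)"
      by (metis mult_1 mult_right_mono norm_ge_zero)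
    also have "\<dots> = s * norm (fcoeff h n)" by (simp add: hg)
    also have "\<dots> \<le> s * (norm (fcoeff h1 n) + norm (fcoeff h2 n))"
      unfolding split using s by (intro mult_left_mono norm_triangle_ineq) auto
    finally show "norm (fcoeff g n) \<le> s * (norm (fcoeff h1 n) + norm (fcoeff h2 n))" .
  qed
  also have "\<dots> = s * ((\<Sum>n\<in>dyadic_block j. norm (fcoeff h1 n)) + (\<Sum>n\<in>dyadic_block j. norm (fcoeff h2 n)))"
    by (simp add: sum_distrib_left sum.distrib distrib_left)
  also have "\<dots> \<le> s * (2 / s * (2 * (D * (s powr \<beta> / \<beta>))) + 8 * D * s powr \<beta> / s)"
    using s by (intro mult_left_mono add_mono sum1 sum2) auto
  also have "\<dots> = (4 / \<beta> + 8) * D * s powr \<beta>"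
    using s \<beta> by (simp add: field_simps)
  finally show ?thesis by (simp add: s_def)
qed

text \<open>The first summand bounds the coefficient at \<open>0\<close>, the second the sum over all dyadic blocks;
  the last factor is the constant of \<open>sum_min_geometric_le\<close> for the ratio \<open>2 powr \<beta>\<close>.\<close>

definition wiener_bound :: "real \<Rightarrow> real \<Rightarrow> real \<Rightarrow> real" where
  "wiener_bound A D \<beta> = 2 * pi * A + (2 * pi * A + (4 / \<beta> + 8) * D) * (4 * 2 powr \<beta> / (2 powr \<beta> - 1))"

text \<open>On the block \<open>j\<close>, with \<open>x = 2 ^ j / u\<close>, the low bound is used for \<open>x \<le> 1\<close>, where
  \<open>sqrt x \<le> x powr \<beta>\<close>, and the high bound, a multiple of \<open>1 / x powr \<beta>\<close>, for \<open>x > 1\<close>.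
  Together they are at most a multiple of \<open>min (x powr \<beta>) (1 / x powr \<beta>)\<close>, whose sum over
  \<open>j\<close> has a bound that is independent of \<open>u\<close>.\<close>

theorem fcoeff_abs_sum_le:
  assumes ac: "absolutely_continuous_on {-pi..pi} g" and per: "g pi = g (-pi)"
    and u: "u > 0" and A: "A \<ge> 0" and D: "D \<ge> 0" and \<beta>: "0 < \<beta>" "\<beta> \<le> 1/4"
    and gA: "\<And>k. k \<in> {-pi..pi} \<Longrightarrow> norm (g k) \<le> A / (1 + (u * k)\<^sup>2)"
    and gD: "AE k in torus. \<exists>d. (g has_vector_derivative d) (at k) \<and> norm d \<le> D * u powr \<beta> * \<bar>k\<bar> powr (\<beta> - 1)"
    and F: "finite F"
  shows "(\<Sum>n\<in>F. norm (fcoeff g n)) \<le> wiener_bound A D \<beta>"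
proof -
  define P where "P k d \<longleftrightarrow> (g has_vector_derivative d) (at k) \<and> norm d \<le> D * u powr \<beta> * \<bar>k\<bar> powr (\<beta> - 1)" for k d
  define N where "N = {k \<in> {-pi..pi}. \<not> (\<exists>d. P k d)}"
  \<comment> \<open>A derivative that obeys its bound at every point, at the price of the value \<open>0\<close> on a null set.\<close>
  define h where "h k = (if \<exists>d. P k d then SOME d. P k d else 0)" for k
  have N: "negligible N"
    using AE_lebesgue_on_negligible[OF gD] unfolding N_def P_def by simp
  have hP: "P k (h k)" if "k \<in> {-pi..pi} - N" for k
  proof -
    have ex: "\<exists>d. P k d" using that by (auto simp: N_def)
    then show ?thesis using someI_ex[OF ex] by (simp add: h_def)
  qed
  have hd: "(g has_vector_derivative h k) (at k)" if "k \<in> {-pi..pi} - N" for k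
    using hP[OF that] by (simp add: P_def)
  have hD: "norm (h k) \<le> D * u powr \<beta> * \<bar>k\<bar> powr (\<beta> - 1)" if "k \<in> {-pi..pi}" for k
  proof (cases "k \<in> N")
    case True then show ?thesis using D by (simp add: h_def N_def)
  next
    case False then show ?thesis using hP[of k] that by (simp add: P_def)
  qed
  have "(h has_integral (g pi - g (-pi))) {-pi..pi}"
    by (rule fundamental_theorem_of_calculus_absolutely_continuous[OF _ ac N])
       (simp, rule has_vector_derivative_at_within[OF hd])
  then have hm: "h \<in> borel_measurable torus"
    by (intro integrable_imp_measurable) (auto simp: integrable_on_def)
  have [measurable]: "h \<in> borel_measurable torus" by (rule hm)
  have "((\<lambda>k. D * u powr \<beta> * k powr (\<beta> - 1)) has_integral D * u powr \<beta> * (pi powr (\<beta> - 1 + 1) / (\<beta> - 1 + 1))) {0..pi}"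
    by (intro has_integral_mult_right has_integral_powr_from_0) (use \<beta> in auto)
  then have "integrable torus (\<lambda>k. norm (h k))"
    by (rule torus_integral_le_even(1)) (use D hD in auto)
  then have hi: "integrable torus h" by (subst integrable_norm_iff[symmetric]) auto
  have hg: "norm (fcoeff h n) = \<bar>of_int n\<bar> * norm (fcoeff g n)" for n
    using fcoeff_derivative[OF ac per N hd hi, of n] by (simp add: norm_mult)
  have cont: "continuous_on {-pi..pi} g"
    by (rule absolutely_continuous_on_imp_continuous_on[OF ac]) auto
  define E where "E = 2 * pi * A + (4 / \<beta> + 8) * D"
  have E: "2 * pi * A \<le> E" "(4 / \<beta> + 8) * D \<le> E" "E \<ge> 0"
    using A D \<beta> by (auto simp: E_def)
  define \<rho> where "\<rho> = (2::real) powr \<beta>"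
  have \<rho>: "\<rho> > 1" using \<beta> by (simp add: \<rho>_def)
  define y where "y = (1 / u) powr \<beta>"
  have y: "y > 0" using u by (simp add: y_def)
  have block: "(\<Sum>n\<in>dyadic_block j. norm (fcoeff g n)) \<le> E * min (y * \<rho> ^ j) (1 / (y * \<rho> ^ j))" for j
  proof -
    define x where "x = 2 ^ j / u"
    have x: "x > 0" using u by (simp add: x_def)
    have "\<rho> ^ j = (2 ^ j) powr \<beta>"
      by (simp add: \<rho>_def powr_powr powr_realpow[symmetric] mult.commute)
    then have xy: "x powr \<beta> = y * \<rho> ^ j"
      using u by (simp add: x_def y_def powr_divide powr_one)
    have low: "(\<Sum>n\<in>dyadic_block j. norm (fcoeff g n)) \<le> 2 * pi * A * sqrt x"
      unfolding x_def by (rule low_block_bound[OF cont u A gA])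
    have "(\<Sum>n\<in>dyadic_block j. norm (fcoeff g n)) \<le> (4 / \<beta> + 8) * (D * u powr \<beta>) * (1 / 2 ^ j) powr \<beta>"
      by (rule high_block_bound[OF hm _ \<beta> hD hg]) (use D in auto)
    also have "\<dots> = (4 / \<beta> + 8) * D * (1 / x powr \<beta>)"
      using u by (simp add: x_def powr_divide)
    finally have high: "(\<Sum>n\<in>dyadic_block j. norm (fcoeff g n)) \<le> (4 / \<beta> + 8) * D * (1 / x powr \<beta>)" .
    show ?thesis
    proof (cases "x \<le> 1")
      case True
      have "sqrt x \<le> x powr \<beta>"
        using x \<beta> True by (simp add: powr_half_sqrt[symmetric] powr_mono')
      then have "2 * pi * A * sqrt x \<le> E * x powr \<beta>"
        using E A x by (intro mult_mono) auto
      moreover have "x powr \<beta> \<le> 1" using x \<beta> True by (simp add: powr_le1)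
      then have "x powr \<beta> \<le> 1 / x powr \<beta>"
        using x by (simp add: field_simps mult_le_one)
      ultimately show ?thesis using low unfolding xy[symmetric] by simp
    next
      case False
      have "(4 / \<beta> + 8) * D * (1 / x powr \<beta>) \<le> E * (1 / x powr \<beta>)"
        by (intro mult_right_mono E) auto
      moreover have "1 \<le> x powr \<beta>" using \<beta> False by (simp add: ge_one_powr_ge_zero)
      then have "1 / x powr \<beta> \<le> x powr \<beta>"
        by (meson divide_le_eq_1 order_trans zero_less_one less_le_trans)
      ultimately show ?thesis using high unfolding xy[symmetric] by simp
    qed
  qed
  obtain J where J: "F \<subseteq> insert 0 (\<Union>j<J. dyadic_block j)"
    by (rule finite_int_subset_dyadic[OF F])
  have fin: "finite (\<Union>j<J. dyadic_block j)" by (auto simp: finite_dyadic_block)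
  have "norm (fcoeff g 0) \<le> (\<integral>k. norm (g k) \<partial>torus)" by (rule norm_fcoeff_le)
  also have "\<dots> \<le> (\<integral>k. A \<partial>torus)"
  proof (rule integral_mono)
    show "integrable torus (\<lambda>k. norm (g k))"
      by (intro integrable_norm continuous_imp_integrable_real cont)
    fix k assume "k \<in> space torus"
    then have "norm (g k) \<le> A / (1 + (u * k)\<^sup>2)" by (intro gA) auto
    also have "\<dots> \<le> A" using A by (simp add: divide_le_eq mult_le_cancel_left1 add_pos_nonneg)
    finally show "norm (g k) \<le> A" .
  qed (simp add: finite_measure.integrable_const[OF finite_measure_torus])
  also have "\<dots> = 2 * pi * A" by (simp add: measure_restrict_space)
  finally have zero: "norm (fcoeff g 0) \<le> 2 * pi * A" .
  have "(\<Sum>n\<in>F. norm (fcoeff g n)) \<le> (\<Sum>n\<in>insert 0 (\<Union>j<J. dyadic_block j). norm (fcoeff g n))"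
    by (rule sum_mono2[OF _ J]) (use fin in auto)
  also have "\<dots> = norm (fcoeff g 0) + (\<Sum>n\<in>(\<Union>j<J. dyadic_block j). norm (fcoeff g n))"
    by (rule sum.insert[OF fin]) (auto simp: dyadic_block_def)
  also have "(\<Sum>n\<in>(\<Union>j<J. dyadic_block j). norm (fcoeff g n)) = (\<Sum>j<J. \<Sum>n\<in>dyadic_block j. norm (fcoeff g n))"
    by (rule sum.UNION_disjoint) (auto simp: finite_dyadic_block disjoint_dyadic_blocks)
  also have "\<dots> \<le> (\<Sum>j<J. E * min (y * \<rho> ^ j) (1 / (y * \<rho> ^ j)))"
    by (rule sum_mono) (rule block)
  also have "\<dots> = E * (\<Sum>j<J. min (y * \<rho> ^ j) (1 / (y * \<rho> ^ j)))" by (simp only: sum_distrib_left)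
  also have "\<dots> \<le> E * (4 * \<rho> / (\<rho> - 1))"
    by (rule mult_left_mono[OF sum_min_geometric_le[OF \<rho> y] E(3)])
  also note zero
  finally show ?thesis unfolding wiener_bound_def E_def \<rho>_def by simp
qed

section \<open>Injectivity of the Fourier transform\<close>

lemma integrable_exp_mult:
  assumes "integrable lebesgue f"
  shows "integrable lebesgue (\<lambda>x. exp (\<i> * of_real (k * x)) * f x)"
proof (rule Bochner_Integration.integrable_bound[OF assms])
  have "(\<lambda>x. exp (\<i> * of_real (k * x))) \<in> borel_measurable lebesgue"
    by (intro measurable_completion) simp
  then show "(\<lambda>x. exp (\<i> * of_real (k * x)) * f x) \<in> borel_measurable lebesgue"
    using assms by simp
qed (auto simp: norm_mult)

lemma fourier_diff:
  assumes "f \<in> L1" "g \<in> L1"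
  shows "fourier (\<lambda>x. f x - g x) k = fourier f k - fourier g k"
  using integrable_exp_mult[of f k] integrable_exp_mult[of g k] assms
  unfolding fourier_def L1_def by (simp add: right_diff_distrib)

text \<open>The positive and the negative part of \<open>g\<close> have the same Fourier transform, hence, by its
  value at \<open>0\<close>, the same mass. If it is positive, they are after normalization densities of
  two distributions with equal characteristic functions, and Levy's uniqueness theorem shows
  that they agree; so their difference \<open>g\<close> vanishes.\<close>

lemma fourier_eq_0_real_imp_AE_0_borel:
  fixes g :: "real \<Rightarrow> real"
  assumes g: "integrable lborel g"
    and 0: "\<And>k. (\<integral>x. exp (\<i> * of_real (k * x)) * of_real (g x) \<partial>lborel) = 0"
  shows "AE x in lborel. g x = 0"
proof -
  define p q where "p x = max (g x) 0" and "q x = max (- g x) 0" for x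
  have [measurable]: "g \<in> borel_measurable lborel" using g by auto
  have [measurable]: "p \<in> borel_measurable lborel" "q \<in> borel_measurable lborel"
    unfolding p_def q_def by measurable
  have ip: "integrable lborel p" and iq: "integrable lborel q"
    unfolding p_def q_def using g by auto
  have pq: "g x = p x - q x" "p x \<ge> 0" "q x \<ge> 0" for x by (auto simp: p_def q_def)
  have ie: "integrable lborel (\<lambda>x. exp (\<i> * of_real (k * x)) * of_real (r x))"
    if "integrable lborel r" for k and r :: "real \<Rightarrow> real"
    by (rule Bochner_Integration.integrable_bound[OF that]) (use that in \<open>auto simp: norm_mult\<close>)
  have eq: "(\<integral>x. exp (\<i> * of_real (k * x)) * of_real (p x) \<partial>lborel) = (\<integral>x. exp (\<i> * of_real (k * x)) * of_real (q x) \<partial>lborel)" for k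
    using 0[of k] ie[OF ip, of k] ie[OF iq, of k] unfolding pq(1) of_real_diff right_diff_distrib by simp
  define m where "m = (\<integral>x. p x \<partial>lborel)"
  have mq: "m = (\<integral>x. q x \<partial>lborel)"
    using eq[of 0] by (simp add: m_def)
  show ?thesis
  proof (cases "m = 0")
    case True
    then have "AE x in lborel. p x = 0" "AE x in lborel. q x = 0"
      using integral_nonneg_eq_0_iff_AE[OF ip] integral_nonneg_eq_0_iff_AE[OF iq] pq mq by (auto simp: m_def)
    then show ?thesis by eventually_elim (simp add: pq(1))
  next
    case False
    then have m: "m > 0" using pq by (simp add: m_def less_le integral_nonneg_AE)
    define R where "R r = density lborel (\<lambda>x. ennreal (r x / m))" for r :: "real \<Rightarrow> real"
    have dist: "real_distribution (R r)"
      if r: "integrable lborel r" "\<And>x. r x \<ge> 0" "(\<integral>x. r x \<partial>lborel) = m" for r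
    proof -
      have [measurable]: "r \<in> borel_measurable lborel" using r by auto
      have "emeasure (R r) (space (R r)) = (\<integral>\<^sup>+x. ennreal (r x / m) \<partial>lborel)"
        unfolding R_def by (simp add: emeasure_density)
      also have "\<dots> = ennreal (\<integral>x. r x / m \<partial>lborel)"
        by (rule nn_integral_eq_integral) (use r m in auto)
      also have "\<dots> = 1" using r m by simp
      finally have "prob_space (R r)" by (rule prob_spaceI)
      then show ?thesis
        unfolding real_distribution_def real_distribution_axioms_def by (auto simp: R_def)
    qed
    have char: "char (R r) t = (\<integral>x. exp (\<i> * of_real (t * x)) * of_real (r x) \<partial>lborel) / m"
      if r: "integrable lborel r" "\<And>x. r x \<ge> 0" for r t
    proof -
      have [measurable]: "r \<in> borel_measurable lborel" using r by auto
      have "char (R r) t = (\<integral>x. (r x / m) *\<^sub>R exp (\<i> * of_real (t * x)) \<partial>lborel)"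
        unfolding char_def R_def by (rule integral_density) (use r m in auto)
      also have "\<dots> = (\<integral>x. (exp (\<i> * of_real (t * x)) * of_real (r x)) / m \<partial>lborel)"
        by (simp add: scaleR_conv_of_real mult.commute)
      finally show ?thesis by simp
    qed
    have "R p = R q"
    proof (rule Levy_uniqueness)
      show "char (R p) = char (R q)"
        using char[OF ip pq(2)] char[OF iq pq(3)] eq by (simp add: fun_eq_iff)
    qed (use dist ip iq pq mq m_def in auto)
    then have "AE x in lborel. ennreal (p x / m) = ennreal (q x / m)"
      unfolding R_def by (subst (asm) sigma_finite_measure.density_unique_iff[OF sigma_finite_lborel]) auto
    then show ?thesis
    proof eventually_elim
      case (elim x)
      then have "p x = q x" using m pq[of x] by (simp add: ennreal_inj)
      then show ?case by (simp add: pq(1))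
    qed
  qed
qed

lemma fourier_eq_0_real_imp_AE_0:
  fixes g :: "real \<Rightarrow> real"
  assumes g: "integrable lebesgue g"
    and 0: "\<And>k. fourier (\<lambda>x. of_real (g x)) k = 0"
  shows "AE x in lebesgue. g x = 0"
proof -
  obtain g' where g': "g' \<in> borel_measurable lborel" "AE x in lborel. g x = g' x"
    using completion_ex_borel_measurable_real[of g lborel] g by auto
  have ae: "AE x in lebesgue. g x = g' x" using g'(2) by (rule AE_completion)
  have "integrable lebesgue g'"
    by (rule integrable_cong_AE_imp[OF g]) (use g' ae in \<open>auto intro: measurable_completion\<close>)
  then have g'i: "integrable lborel g'" using g'(1) by (simp add: integrable_completion)
  have "AE x in lborel. g' x = 0"
  proof (rule fourier_eq_0_real_imp_AE_0_borel[OF g'i])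
    fix k
    have m: "(\<lambda>x. exp (\<i> * of_real (k * x)) * of_real (g' x)) \<in> borel_measurable lborel" using g'(1) by simp
    have "(\<integral>x. exp (\<i> * of_real (k * x)) * of_real (g' x) \<partial>lborel) = (\<integral>x. exp (\<i> * of_real (k * x)) * of_real (g' x) \<partial>lebesgue)"
      using m by (simp add: integral_completion)
    also have "\<dots> = fourier (\<lambda>x. of_real (g x)) k"
      unfolding fourier_def
    proof (rule integral_cong_AE)
      show "(\<lambda>x. exp (\<i> * of_real (k * x)) * of_real (g' x)) \<in> borel_measurable lebesgue"
        using m by (rule measurable_completion)
      show "(\<lambda>x. exp (\<i> * of_real (k * x)) * of_real (g x)) \<in> borel_measurable lebesgue"
        by (rule borel_measurable_integrable[OF integrable_exp_mult]) (use g in auto)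
      show "AE x in lebesgue. exp (\<i> * of_real (k * x)) * of_real (g' x) = exp (\<i> * of_real (k * x)) * complex_of_real (g x)"
        using ae by eventually_elim simp
    qed
    finally show "(\<integral>x. exp (\<i> * of_real (k * x)) * of_real (g' x) \<partial>lborel) = 0" using 0 by simp
  qed
  from AE_completion[OF this] ae show ?thesis by eventually_elim simp
qed

text \<open>The transform of \<open>cnj f\<close> at \<open>k\<close> is the conjugate of the transform of \<open>f\<close> at \<open>-k\<close>. Hence the
  real and the imaginary part of \<open>f\<close> also have zero transform, which reduces the claim to
  real functions.\<close>

theorem fourier_eq_0_imp_AE_0:
  assumes f: "f \<in> L1" and 0: "\<And>k. fourier f k = 0"
  shows "AE x in lebesgue. f x = 0"
proof -
  have fi: "integrable lebesgue f" using f by (simp add: L1_def)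
  have cnj: "(\<integral>x. exp (\<i> * of_real (k * x)) * cnj (f x) \<partial>lebesgue) = 0" for k
  proof -
    have "exp (\<i> * of_real (k * x)) * cnj (f x) = cnj (exp (\<i> * of_real (- k * x)) * f x)" for x
      by (simp add: exp_cnj)
    then have "(\<integral>x. exp (\<i> * of_real (k * x)) * cnj (f x) \<partial>lebesgue)
        = (\<integral>x. cnj (exp (\<i> * of_real (- k * x)) * f x) \<partial>lebesgue)"
      by (simp only:)
    also have "\<dots> = cnj (fourier f (- k))"
      unfolding fourier_def
      by (rule integral_bounded_linear[OF bounded_linear_cnj integrable_exp_mult[OF fi]])
    finally show ?thesis using 0 by simp
  qed
  have i: "integrable lebesgue (\<lambda>x. exp (\<i> * of_real (k * x)) * f x)"
    "integrable lebesgue (\<lambda>x. exp (\<i> * of_real (k * x)) * cnj (f x))" for k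
    by (intro integrable_exp_mult; use fi in simp)+
  have z: "(\<integral>x. exp (\<i> * of_real (k * x)) * f x \<partial>lebesgue) = 0" for k using 0 by (simp add: fourier_def)
  have "AE x in lebesgue. Re (f x) = 0"
  proof (rule fourier_eq_0_real_imp_AE_0)
    fix k
    have e: "complex_of_real (Re (f x)) = f x * (1/2) + cnj (f x) * (1/2)" for x by (simp add: complex_eq_iff)
    have "fourier (\<lambda>x. complex_of_real (Re (f x))) k
      = (\<integral>x. exp (\<i> * of_real (k * x)) * f x * (1/2) + exp (\<i> * of_real (k * x)) * cnj (f x) * (1/2) \<partial>lebesgue)"
      unfolding fourier_def e by (simp add: distrib_left mult.assoc)
    also have "\<dots> = 0" using i[of k] z[of k] cnj[of k]
      by (subst Bochner_Integration.integral_add) auto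
    finally show "fourier (\<lambda>x. complex_of_real (Re (f x))) k = 0" .
  qed (use fi in auto)
  moreover have "AE x in lebesgue. Im (f x) = 0"
  proof (rule fourier_eq_0_real_imp_AE_0)
    fix k
    have e: "complex_of_real (Im (f x)) = f x * (-\<i>/2) + cnj (f x) * (\<i>/2)" for x by (simp add: complex_eq_iff)
    have "fourier (\<lambda>x. complex_of_real (Im (f x))) k
      = (\<integral>x. exp (\<i> * of_real (k * x)) * f x * (-\<i>/2) + exp (\<i> * of_real (k * x)) * cnj (f x) * (\<i>/2) \<partial>lebesgue)"
      unfolding fourier_def e by (simp only: distrib_left mult.assoc)
    also have "\<dots> = (\<integral>x. exp (\<i> * of_real (k * x)) * f x * (-\<i>/2) \<partial>lebesgue) + (\<integral>x. exp (\<i> * of_real (k * x)) * cnj (f x) * (\<i>/2) \<partial>lebesgue)"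
      by (intro Bochner_Integration.integral_add integrable_mult_left i)
    also have "\<dots> = 0" unfolding integral_mult_left_zero z cnj by simp
    finally show "fourier (\<lambda>x. complex_of_real (Im (f x))) k = 0" .
  qed (use fi in auto)
  ultimately show ?thesis by eventually_elim (simp add: complex_eq_iff)
qed

section \<open>Periodic multipliers\<close>

lemma AE_summable_norm:
  fixes f :: "nat \<Rightarrow> 'a \<Rightarrow> 'b::{banach, second_countable_topology}"
  assumes f: "\<And>j. integrable M (f j)" and s: "summable (\<lambda>j. \<integral>x. norm (f j x) \<partial>M)"
  shows "AE x in M. summable (\<lambda>j. norm (f j x))"
proof -
  have [measurable]: "f j \<in> borel_measurable M" for j using f by auto
  have "(\<integral>\<^sup>+x. (\<Sum>j. ennreal (norm (f j x))) \<partial>M) = (\<Sum>j. \<integral>\<^sup>+x. ennreal (norm (f j x)) \<partial>M)"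
    by (rule nn_integral_suminf) auto
  also have "\<dots> = (\<Sum>j. ennreal (\<integral>x. norm (f j x) \<partial>M))"
    by (intro suminf_cong nn_integral_eq_integral integrable_norm f) auto
  also have "\<dots> \<noteq> \<infinity>"
    unfolding infinity_ennreal_def by (rule ennreal_suminf_neq_top[OF s]) simp
  finally have "AE x in M. (\<Sum>j. ennreal (norm (f j x))) \<noteq> \<infinity>"
    by (intro nn_integral_PInf_AE) auto
  then show ?thesis
    by eventually_elim (auto intro: summable_suminf_not_top)
qed

lemma norm_integral_suminf_le:
  fixes f :: "nat \<Rightarrow> 'a \<Rightarrow> 'b::{banach, second_countable_topology}"
  assumes f: "\<And>j. integrable M (f j)" and s: "summable (\<lambda>j. \<integral>x. norm (f j x) \<partial>M)"
  shows "(\<integral>x. norm (\<Sum>j. f j x) \<partial>M) \<le> (\<Sum>j. \<integral>x. norm (f j x) \<partial>M)"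
proof -
  have ae: "AE x in M. summable (\<lambda>j. norm (f j x))" by (rule AE_summable_norm[OF f s])
  have ae': "AE x in M. summable (\<lambda>j. norm (norm (f j x)))" using ae by simp
  have s': "summable (\<lambda>j. \<integral>x. norm (norm (f j x)) \<partial>M)" using s by simp
  have nf: "integrable M (\<lambda>x. norm (f j x))" for j using f by simp
  have "(\<integral>x. norm (\<Sum>j. f j x) \<partial>M) \<le> (\<integral>x. (\<Sum>j. norm (f j x)) \<partial>M)"
  proof (rule integral_mono_AE)
    show "integrable M (\<lambda>x. norm (\<Sum>j. f j x))"
      by (intro integrable_norm integrable_suminf f ae s)
    show "integrable M (\<lambda>x. \<Sum>j. norm (f j x))"
      by (rule integrable_suminf[OF nf ae' s'])
    show "AE x in M. norm (\<Sum>j. f j x) \<le> (\<Sum>j. norm (f j x))"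
      using ae by eventually_elim (rule summable_norm)
  qed
  also have "\<dots> = (\<Sum>j. \<integral>x. norm (f j x) \<partial>M)"
    by (rule integral_suminf[OF nf ae' s'])
  finally show ?thesis .
qed

text \<open>Multiplication of the transform by \<open>cis (m * k)\<close> is translation by \<open>m\<close>, which preserves the
  \<open>L\<^sub>1\<close> norm. So the series \<open>v = \<Sum>j. a j * f (x - m j)\<close> converges in \<open>L\<^sub>1\<close> and has the
  transform \<open>\<phi> k * fourier f k\<close>. Injectivity of the transform carries the norm bound over to
  the function chosen by \<open>multiplier_op\<close>.\<close>

theorem L1_multiplier_trigonometric_series:
  fixes a :: "nat \<Rightarrow> complex" and m :: "nat \<Rightarrow> int"
  assumes \<phi>: "\<phi> \<in> borel_measurable lebesgue"
    and a: "summable (\<lambda>j. norm (a j))" "(\<Sum>j. norm (a j)) \<le> K"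
    and s: "\<And>k. (\<lambda>j. a j * cis (of_int (m j) * k)) sums \<phi> k"
  shows "L1_multiplier \<phi>" "L1_op_norm (multiplier_op \<phi>) \<le> ennreal K"
proof -
  have main: "\<exists>v\<in>L1. (\<forall>k. \<phi> k * fourier f k = fourier v k) \<and> L1_norm v \<le> K * L1_norm f"
    if "f \<in> L1" for f
  proof -
    have f: "integrable lebesgue f" using that by (simp add: L1_def)
    define F where "F j x = a j * f (- of_int (m j) + 1 * x)" for j x
    have Fi: "integrable lebesgue (F j)" for j
      unfolding F_def by (intro integrable_mult_right lebesgue_integrable_real_affine f) simp
    have Fn: "(\<integral>x. norm (F j x) \<partial>lebesgue) = norm (a j) * L1_norm f" for j
      using lebesgue_integral_real_affine[of 1 "\<lambda>x. norm (f x)" "- of_int (m j)"]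
      unfolding F_def L1_norm_def by (simp add: norm_mult)
    have Fs: "summable (\<lambda>j. \<integral>x. norm (F j x) \<partial>lebesgue)"
      unfolding Fn by (intro summable_mult2 a)
    note ae = AE_summable_norm[OF Fi Fs]
    define v where "v x = (\<Sum>j. F j x)" for x
    have vi: "integrable lebesgue v"
      unfolding v_def by (rule integrable_suminf[OF Fi ae Fs])
    have "L1_norm v \<le> (\<Sum>j. \<integral>x. norm (F j x) \<partial>lebesgue)"
      unfolding L1_norm_def v_def by (rule norm_integral_suminf_le[OF Fi Fs])
    also have "\<dots> = (\<Sum>j. norm (a j)) * L1_norm f"
      unfolding Fn by (rule suminf_mult2[OF a(1), symmetric])
    also have "\<dots> \<le> K * L1_norm f"
      by (intro mult_right_mono a) (simp add: L1_norm_def)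
    finally have norm: "L1_norm v \<le> K * L1_norm f" .
    have "\<phi> k * fourier f k = fourier v k" for k
    proof -
      define G where "G j x = exp (\<i> * of_real (k * x)) * F j x" for j x
      have Gi: "integrable lebesgue (G j)" for j
        unfolding G_def by (rule integrable_exp_mult[OF Fi])
      have Gn: "norm (G j x) = norm (F j x)" for j x by (simp add: G_def norm_mult)
      have "(\<lambda>j. \<integral>x. G j x \<partial>lebesgue) sums (\<integral>x. (\<Sum>j. G j x) \<partial>lebesgue)"
        by (rule sums_integral[OF Gi]) (unfold Gn, rule ae, rule Fs)
      moreover have "(\<integral>x. (\<Sum>j. G j x) \<partial>lebesgue) = fourier v k"
        unfolding fourier_def
      proof (rule integral_cong_AE)
        show "(\<lambda>x. \<Sum>j. G j x) \<in> borel_measurable lebesgue"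
          using Gi by (intro borel_measurable_suminf) auto
        show "(\<lambda>x. exp (\<i> * of_real (k * x)) * v x) \<in> borel_measurable lebesgue"
          by (rule borel_measurable_integrable[OF integrable_exp_mult[OF vi]])
        show "AE x in lebesgue. (\<Sum>j. G j x) = exp (\<i> * of_real (k * x)) * v x"
          using ae
        proof eventually_elim
          case (elim x)
          then show ?case unfolding G_def v_def by (rule suminf_mult[OF summable_norm_cancel])
        qed
      qed
      moreover have "(\<integral>x. G j x \<partial>lebesgue) = a j * cis (of_int (m j) * k) * fourier f k" for j
      proof -
        have e: "G j x = a j * cis (of_int (m j) * k)
            * (exp (\<i> * of_real (k * (- of_int (m j) + 1 * x))) * f (- of_int (m j) + 1 * x))" for x
        proof -
          have "exp (\<i> * of_real (k * x)) = cis (of_int (m j) * k) * exp (\<i> * of_real (k * (- of_int (m j) + 1 * x)))"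
          proof -
            have "k * x = of_int (m j) * k + k * (- of_int (m j) + 1 * x)" by (simp add: algebra_simps)
            from arg_cong[OF this, of complex_of_real]
            have "complex_of_real (k * x) = of_real (of_int (m j) * k) + of_real (k * (- of_int (m j) + 1 * x))"
              by (simp only: of_real_add)
            then have "\<i> * complex_of_real (k * x)
                = \<i> * of_real (of_int (m j) * k) + \<i> * of_real (k * (- of_int (m j) + 1 * x))"
              by (simp only: distrib_left[of "\<i>"])
            then show ?thesis by (simp only: cis_conv_exp exp_add)
          qed
          then show ?thesis unfolding G_def F_def by (simp only: mult_ac)
        qed
        show ?thesis unfolding e fourier_def
          using lebesgue_integral_real_affine[of 1 "\<lambda>x. exp (\<i> * of_real (k * x)) * f x" "- of_int (m j)"]
          by simp
      qed
      ultimately have "(\<lambda>j. a j * cis (of_int (m j) * k) * fourier f k) sums fourier v k" by simp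
      moreover have "(\<lambda>j. a j * cis (of_int (m j) * k) * fourier f k) sums (\<phi> k * fourier f k)"
        by (rule sums_mult2[OF s])
      ultimately show ?thesis by (rule sums_unique2[symmetric])
    qed
    with vi norm show ?thesis by (auto simp: L1_def)
  qed
  then show "L1_multiplier \<phi>" using \<phi> unfolding L1_multiplier_def by blast
  show "L1_op_norm (multiplier_op \<phi>) \<le> ennreal K"
    unfolding L1_op_norm_def
  proof (rule SUP_least)
    fix f assume f: "f \<in> {f \<in> L1. L1_norm f \<le> 1}"
    then obtain v where v: "v \<in> L1" "\<And>k. \<phi> k * fourier f k = fourier v k" "L1_norm v \<le> K * L1_norm f"
      using main[of f] by auto
    define w where "w = multiplier_op \<phi> f"
    have "w \<in> L1 \<and> (\<forall>k. \<phi> k * fourier f k = fourier w k)"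
      unfolding w_def multiplier_op_def by (rule someI[of _ v]) (use v in auto)
    then have w: "w \<in> L1" "\<And>k. fourier w k = fourier v k" using v(2) by auto
    have "AE x in lebesgue. w x - v x = 0"
    proof (rule fourier_eq_0_imp_AE_0)
      show "(\<lambda>x. w x - v x) \<in> L1" using w v by (simp add: L1_def)
      show "fourier (\<lambda>x. w x - v x) k = 0" for k by (simp add: fourier_diff w v)
    qed
    then have "AE x in lebesgue. norm (w x) = norm (v x)" by eventually_elim simp
    then have "L1_norm w = L1_norm v"
      unfolding L1_norm_def using w(1) v(1) by (intro integral_cong_AE) (auto simp: L1_def)
    also have "\<dots> \<le> K * 1"
    proof (rule order_trans[OF v(3)], rule mult_left_mono)
      show "0 \<le> K" using suminf_nonneg[OF a(1)] a(2) by simp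
    qed (use f in auto)
    finally show "ennreal (L1_norm (multiplier_op \<phi> f)) \<le> ennreal K"
      unfolding w_def by (intro ennreal_leI) simp
  qed
qed

lemma continuous_on_periodic_2pi:
  assumes g: "continuous_on {-pi..pi} g" and per: "periodic_2pi g"
  shows "continuous_on UNIV g"
proof -
  have "continuous_on {pi..3 * pi} (\<lambda>x. g (x - 2 * pi))"
    by (rule continuous_on_compose2[OF g]) (auto intro!: continuous_intros)
  moreover have "g (x - 2 * pi) = g x" for x
    using periodic_2pi_shift[OF per, of x "-1"] by simp
  ultimately have "continuous_on {pi..3 * pi} g" by simp
  from continuous_on_closed_Un[OF _ _ g this]
  have "continuous_on ({-pi..pi} \<union> {pi..3 * pi}) g" by simp
  then have big: "continuous_on {-pi<..<3 * pi} g"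
    by (rule continuous_on_subset) auto
  have "isCont g x" for x
  proof -
    have *: "isCont g (x + 2 * pi * of_int n) \<Longrightarrow> isCont g x" for n :: int
    proof -
      assume "isCont g (x + 2 * pi * of_int n)"
      then have "isCont (\<lambda>y. g (y + 2 * pi * of_int n)) x"
        by (intro continuous_at_compose[of x "\<lambda>y. y + 2 * pi * of_int n" g, unfolded o_def]) auto
      then show "isCont g x" unfolding periodic_2pi_shift[OF per] .
    qed
    obtain n where n: "x + 2 * pi * of_int n \<in> {-pi..pi}" by (rule reduce_mod_2pi)
    obtain l where l: "x + 2 * pi * of_int l \<in> {-pi<..<3 * pi}"
    proof (cases "x + 2 * pi * of_int n = -pi")
      case True
      then have "x + 2 * pi * of_int (n + 1) = pi" by (simp add: algebra_simps)
      then show ?thesis using that[of "n + 1"] pi_gt_zero by (simp del: of_int_add)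
    next
      case False
      show ?thesis by (rule that[of n]) (use n False pi_gt_zero in auto)
    qed
    have "isCont g (x + 2 * pi * of_int l)"
      using big l by (simp add: continuous_on_eq_continuous_at)
    then show ?thesis by (rule *)
  qed
  then show ?thesis by (simp add: continuous_at_imp_continuous_on)
qed

text \<open>The factor \<open>r\<close> serves to pass from \<open>t \<psi> exp (t \<psi>)\<close>, whose coefficients are bounded uniformly
  in \<open>t\<close>, to \<open>\<psi> exp (t \<psi>)\<close>.\<close>

theorem L1_multiplier_periodic:
  assumes ac: "absolutely_continuous_on {-pi..pi} g" and per: "periodic_2pi g"
    and diff: "AE k in torus. \<exists>d. (g has_vector_derivative d) (at k)"
    and K: "\<And>F. finite F \<Longrightarrow> (\<Sum>n\<in>F. norm (fcoeff g n)) \<le> K"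
    and r: "(r::real) \<ge> 0"
  shows "L1_multiplier (\<lambda>k. of_real r * g k)"
    "L1_op_norm (multiplier_op (\<lambda>k. of_real r * g k)) \<le> ennreal (r * K)"
proof -
  have cont: "continuous_on UNIV g"
    by (intro continuous_on_periodic_2pi absolutely_continuous_on_imp_continuous_on[OF ac] per) auto
  define a where "a j = of_real (r / (2 * pi)) * fcoeff g (int_decode j)" for j
  have part: "(\<Sum>j<n. norm (fcoeff g (int_decode j))) \<le> K" for n
  proof -
    have "(\<Sum>j<n. norm (fcoeff g (int_decode j))) = (\<Sum>n\<in>int_decode ` {..<n}. norm (fcoeff g n))"
      by (subst sum.reindex) (auto intro: inj_on_subset[OF inj_int_decode])
    also have "\<dots> \<le> K" by (rule K) auto
    finally show ?thesis .
  qed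
  have summ: "summable (\<lambda>j. norm (fcoeff g (int_decode j)))"
    by (rule summableI_nonneg_bounded[OF _ part]) auto
  have na: "norm (a j) = r / (2 * pi) * norm (fcoeff g (int_decode j))" for j
    using r by (simp add: a_def norm_mult norm_divide)
  have K0: "K \<ge> 0" using K[of "{}"] by simp
  have 1: "summable (\<lambda>j. norm (a j))" unfolding na by (intro summable_mult summ)
  have "(\<Sum>j. norm (a j)) = r / (2 * pi) * (\<Sum>j. norm (fcoeff g (int_decode j)))"
    unfolding na by (rule suminf_mult[OF summ])
  also have "\<dots> \<le> r / (2 * pi) * K"
    by (intro mult_left_mono suminf_le_const summ part) (use r in auto)
  also have "\<dots> \<le> r * K"
  proof -
    have "r * K * (1 / (2 * pi)) \<le> r * K * 1"
      using r K0 pi_ge_two by (intro mult_left_mono) auto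
    then show ?thesis by simp
  qed
  finally have 2: "(\<Sum>j. norm (a j)) \<le> r * K" .
  have 3: "(\<lambda>j. a j * cis (of_int (int_decode j) * k)) sums (of_real r * g k)" for k
    using sums_mult[OF fourier_series_sums[OF cont per diff summ, of k], of "of_real (r / (2 * pi))"]
    by (simp add: a_def mult.assoc)
  have 4: "(\<lambda>k. of_real r * g k) \<in> borel_measurable lebesgue"
    by (intro measurable_completion borel_measurable_times borel_measurable_const)
       (use borel_measurable_continuous_onI[OF cont] in simp)
  show "L1_multiplier (\<lambda>k. of_real r * g k)"
    "L1_op_norm (multiplier_op (\<lambda>k. of_real r * g k)) \<le> ennreal (r * K)"
    by (rule L1_multiplier_trigonometric_series[OF 4 1 2 3])+
qed

section \<open>The exponential of a symbol\<close>

lemma power_le_fact_mult_exp: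
  assumes "(y::real) \<ge> 0" shows "y ^ n \<le> fact n * exp y"
proof -
  have "(\<Sum>j\<in>{n}. y ^ j /\<^sub>R fact j) \<le> (\<Sum>j. y ^ j /\<^sub>R fact j)"
    by (intro sum_le_suminf summable_exp_generic) (use assms in auto)
  then have "y ^ n / fact n \<le> exp y" by (simp add: exp_def divide_inverse mult.commute)
  then show ?thesis by (simp add: divide_le_eq mult.commute)
qed

lemma powr_mult_exp_bounded:
  assumes "(c::real) > 0" "p \<ge> 0"
  obtains M where "M > 0" "\<And>x. x \<ge> 0 \<Longrightarrow> (1 + x) powr p * exp (- (c * x)) \<le> M"
proof -
  define n where "n = nat \<lceil>p\<rceil>"
  have n: "p \<le> real n" unfolding n_def by linarith
  show ?thesis
  proof (rule that[of "fact n / c ^ n * exp c"])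
    show "fact n / c ^ n * exp c > 0" using assms by simp
    fix x :: real assume x: "x \<ge> 0"
    have "(1 + x) powr p \<le> (1 + x) powr real n" using n x by (intro powr_mono) auto
    also have "\<dots> = (1 + x) ^ n" using x by (simp add: powr_realpow)
    also have "\<dots> = (c * (1 + x)) ^ n / c ^ n" using assms by (simp add: power_mult_distrib)
    also have "\<dots> \<le> fact n * exp (c * (1 + x)) / c ^ n"
      using assms x by (intro divide_right_mono power_le_fact_mult_exp) auto
    finally have "(1 + x) powr p * exp (- (c * x)) \<le> fact n * exp (c * (1 + x)) / c ^ n * exp (- (c * x))"
      by (intro mult_right_mono) auto
    also have "\<dots> = fact n / c ^ n * exp c" by (simp add: distrib_left exp_add exp_minus field_simps)
    finally show "(1 + x) powr p * exp (- (c * x)) \<le> fact n / c ^ n * exp c" .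
  qed
qed

text \<open>The bounds shared by \<open>exp (t \<psi>)\<close> and \<open>t \<psi> exp (t \<psi>)\<close>. In terms of \<open>x = t * \<bar>k\<bar> powr \<alpha>\<close>, the
  factor \<open>1 + x\<close> accounts for the powers of \<open>t \<psi>\<close> that multiply the exponential.\<close>

definition exponential_bounds ::
    "real \<Rightarrow> real \<Rightarrow> real \<Rightarrow> real \<Rightarrow> real \<Rightarrow> (real \<Rightarrow> complex) \<Rightarrow> bool" where
  "exponential_bounds \<alpha> c L L' t g \<longleftrightarrow>
     (\<forall>k\<in>{-pi..pi}. norm (g k) \<le> L * (1 + t * \<bar>k\<bar> powr \<alpha>) * exp (- (c * (t * \<bar>k\<bar> powr \<alpha>)))) \<and>
     (AE k in torus. \<exists>d. (g has_vector_derivative d) (at k) \<and>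
        norm d \<le> L' * (t * \<bar>k\<bar> powr (\<alpha> - 1)) * (1 + t * \<bar>k\<bar> powr \<alpha>) * exp (- (c * (t * \<bar>k\<bar> powr \<alpha>))))"

text \<open>A change of scale: for \<open>u = t powr (1 / \<alpha>)\<close> the quantity \<open>x = t * \<bar>k\<bar> powr \<alpha>\<close> equals
  \<open>(u * \<bar>k\<bar>) powr \<alpha>\<close>, and the factor \<open>exp (- c * x)\<close> absorbs all powers of \<open>1 + x\<close>. The
  exponent \<open>\<beta> = min \<alpha> (1/4)\<close> is small enough for the dyadic estimate and satisfies \<open>\<beta> \<le> \<alpha>\<close>,
  so that \<open>t * \<bar>k\<bar> powr (\<alpha> - 1)\<close> is \<open>u powr \<beta> * \<bar>k\<bar> powr (\<beta> - 1)\<close> times a nonnegative power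
  of \<open>x\<close>.\<close>

lemma uniform_fcoeff_bound:
  fixes \<alpha> c L L' :: real
  assumes \<alpha>: "\<alpha> > 0" and c: "c > 0" and L: "L \<ge> 0" and L': "L' \<ge> 0"
  shows "\<exists>K. \<forall>g t F. t > 0 \<and> absolutely_continuous_on {-pi..pi} g \<and> g pi = g (-pi) \<and>
      exponential_bounds \<alpha> c L L' t g \<and> finite F \<longrightarrow> (\<Sum>n\<in>F. norm (fcoeff g n)) \<le> K"
proof -
  obtain M1 where M1: "M1 > 0" "\<And>x. x \<ge> 0 \<Longrightarrow> (1 + x) powr (1 + 2 / \<alpha>) * exp (- (c * x)) \<le> M1"
    using powr_mult_exp_bounded[OF c, of "1 + 2 / \<alpha>"] \<alpha> by auto
  obtain M2 where M2: "M2 > 0" "\<And>x. x \<ge> 0 \<Longrightarrow> (1 + x) powr 2 * exp (- (c * x)) \<le> M2"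
    using powr_mult_exp_bounded[OF c, of 2] by auto
  define \<beta> where "\<beta> = min \<alpha> (1/4)"
  have \<beta>: "0 < \<beta>" "\<beta> \<le> 1/4" "\<beta> \<le> \<alpha>" using \<alpha> by (auto simp: \<beta>_def)
  show ?thesis
  proof (intro exI[of _ "wiener_bound (2 * L * M1) (L' * M2) \<beta>"] allI impI; elim conjE)
    fix g t and F :: "int set"
    assume t: "t > 0" and ac: "absolutely_continuous_on {-pi..pi} g" and per: "g pi = g (-pi)"
      and g: "exponential_bounds \<alpha> c L L' t g" and F: "finite F"
    have gb: "norm (g k) \<le> L * (1 + t * \<bar>k\<bar> powr \<alpha>) * exp (- (c * (t * \<bar>k\<bar> powr \<alpha>)))"
      if "k \<in> {-pi..pi}" for k
      using g that by (simp add: exponential_bounds_def)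
    have gd: "AE k in torus. \<exists>d. (g has_vector_derivative d) (at k) \<and>
        norm d \<le> L' * (t * \<bar>k\<bar> powr (\<alpha> - 1)) * (1 + t * \<bar>k\<bar> powr \<alpha>) * exp (- (c * (t * \<bar>k\<bar> powr \<alpha>)))"
      using g by (simp add: exponential_bounds_def)
    define u where "u = t powr (1 / \<alpha>)"
    have u: "u > 0" using t by (simp add: u_def)
    have ut: "u powr \<alpha> = t" using t \<alpha> by (simp add: u_def powr_powr)
    show "(\<Sum>n\<in>F. norm (fcoeff g n)) \<le> wiener_bound (2 * L * M1) (L' * M2) \<beta>"
    proof (rule fcoeff_abs_sum_le[OF ac per u _ _ \<beta>(1,2) _ _ F])
      fix k assume k: "k \<in> {-pi..pi}"
      define x where "x = t * \<bar>k\<bar> powr \<alpha>"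
      have x: "x \<ge> 0" using t by (simp add: x_def)
      have "(u * k)\<^sup>2 = x powr (2 / \<alpha>)"
      proof (cases "k = 0")
        case False
        have "x powr (2 / \<alpha>) = ((u * \<bar>k\<bar>) powr \<alpha>) powr (2 / \<alpha>)"
          using u by (simp add: x_def ut powr_mult)
        also have "\<dots> = (u * \<bar>k\<bar>) powr 2" using \<alpha> by (simp add: powr_powr)
        also have "\<dots> = (u * \<bar>k\<bar>)\<^sup>2" using u False by (simp add: powr_numeral)
        finally show ?thesis by (simp add: power_mult_distrib)
      qed (simp add: x_def)
      also have "\<dots> \<le> (1 + x) powr (2 / \<alpha>)" using x \<alpha> by (intro powr_mono2) auto
      finally have "1 + (u * k)\<^sup>2 \<le> 2 * (1 + x) powr (2 / \<alpha>)"
        using ge_one_powr_ge_zero[of "1 + x" "2 / \<alpha>"] x \<alpha> by simp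
      then have "norm (g k) * (1 + (u * k)\<^sup>2) \<le> (L * (1 + x) * exp (- (c * x))) * (2 * (1 + x) powr (2 / \<alpha>))"
        using gb[OF k] L x unfolding x_def[symmetric] by (intro mult_mono) auto
      also have "\<dots> = 2 * L * ((1 + x) powr (1 + 2 / \<alpha>) * exp (- (c * x)))"
        using x by (simp add: powr_add)
      also have "\<dots> \<le> 2 * L * M1" by (intro mult_left_mono M1 x) (use L in auto)
      finally show "norm (g k) \<le> 2 * L * M1 / (1 + (u * k)\<^sup>2)"
        by (simp add: pos_le_divide_eq add_pos_nonneg)
    next
      show "AE k in torus. \<exists>d. (g has_vector_derivative d) (at k) \<and>
          norm d \<le> L' * M2 * u powr \<beta> * \<bar>k\<bar> powr (\<beta> - 1)"
        using gd
      proof eventually_elim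
        case (elim k)
        then obtain d where d: "(g has_vector_derivative d) (at k)"
          "norm d \<le> L' * (t * \<bar>k\<bar> powr (\<alpha> - 1)) * (1 + t * \<bar>k\<bar> powr \<alpha>) * exp (- (c * (t * \<bar>k\<bar> powr \<alpha>)))" by blast
        define x where "x = t * \<bar>k\<bar> powr \<alpha>"
        have x: "x \<ge> 0" using t by (simp add: x_def)
        have "t * \<bar>k\<bar> powr (\<alpha> - 1) \<le> u powr \<beta> * \<bar>k\<bar> powr (\<beta> - 1) * (1 + x)"
        proof (cases "k = 0")
          case False
          have "t * \<bar>k\<bar> powr (\<alpha> - 1) = u powr \<beta> * \<bar>k\<bar> powr (\<beta> - 1) * (u * \<bar>k\<bar>) powr (\<alpha> - \<beta>)"
            using u False by (simp add: powr_mult powr_diff powr_add ut[symmetric])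
          also have "(u * \<bar>k\<bar>) powr (\<alpha> - \<beta>) = x powr ((\<alpha> - \<beta>) / \<alpha>)"
          proof -
            have "x = (u * \<bar>k\<bar>) powr \<alpha>" using u by (simp add: x_def ut powr_mult)
            then show ?thesis using \<alpha> by (simp add: powr_powr)
          qed
          also have "x powr ((\<alpha> - \<beta>) / \<alpha>) \<le> (1 + x) powr ((\<alpha> - \<beta>) / \<alpha>)"
            using x \<alpha> \<beta> by (intro powr_mono2) auto
          also have "\<dots> \<le> (1 + x) powr 1" using x \<alpha> \<beta> by (intro powr_mono) auto
          finally show ?thesis using x by (simp add: mult_left_mono)
        qed (use x in simp)
        then have "norm d \<le> L' * (u powr \<beta> * \<bar>k\<bar> powr (\<beta> - 1) * (1 + x)) * (1 + x) * exp (- (c * x))"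
          using d(2) L' x unfolding x_def[symmetric]
          by (elim order_trans, intro mult_right_mono mult_left_mono) auto
        also have "\<dots> = L' * (u powr \<beta> * \<bar>k\<bar> powr (\<beta> - 1)) * ((1 + x) powr 2 * exp (- (c * x)))"
          using x by (simp add: powr_numeral power2_eq_square)
        also have "\<dots> \<le> L' * (u powr \<beta> * \<bar>k\<bar> powr (\<beta> - 1)) * M2"
          by (intro mult_left_mono M2 x) (use L' in auto)
        finally show ?case using d(1) by (auto simp: mult_ac)
      qed
    qed (use L L' M1 M2 in auto)
  qed
qed

text \<open>Continuity extends the bounds on the symbol from almost every point to every point.\<close>

lemma admissible_symbol_bounds:
  assumes adm: "admissible_symbol \<alpha> c C C' \<psi>" and \<alpha>: "\<alpha> > 0" and k: "k \<in> {-pi..pi}"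
  shows "norm (\<psi> k) \<le> C * \<bar>k\<bar> powr \<alpha>" "Re (\<psi> k) \<le> - c * \<bar>k\<bar> powr \<alpha>"
proof -
  have cont: "continuous_on {-pi..pi} \<psi>"
    using adm unfolding admissible_symbol_def
    by (intro absolutely_continuous_on_imp_continuous_on) auto
  have cp: "continuous_on {-pi..pi} (\<lambda>k. D * \<bar>k\<bar> powr \<alpha>)" for D
    using \<alpha> by (intro continuous_on_mult continuous_on_const continuous_on_powr' continuous_intros) auto
  show "norm (\<psi> k) \<le> C * \<bar>k\<bar> powr \<alpha>"
    by (rule continuous_on_AE_le_imp_le[OF continuous_on_norm[OF cont] cp _ _ k])
       (use adm in \<open>auto simp: admissible_symbol_def\<close>)
  show "Re (\<psi> k) \<le> - c * \<bar>k\<bar> powr \<alpha>"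
    by (rule continuous_on_AE_le_imp_le[OF continuous_on_Re[OF cont] cp _ _ k])
       (use adm in \<open>auto simp: admissible_symbol_def\<close>)
qed

lemma absolutely_continuous_on_exp:
  assumes f: "absolutely_continuous_on {a..b} f"
  shows "absolutely_continuous_on {a..b} (\<lambda>x. exp (f x))"
proof -
  have "bounded (f ` {a..b})"
    by (intro compact_imp_bounded compact_continuous_image
         absolutely_continuous_on_imp_continuous_on f is_interval_cc compact_Icc)
  then obtain R where R: "\<And>x. x \<in> {a..b} \<Longrightarrow> norm (f x) \<le> R"
    unfolding bounded_iff by (meson imageI)
  show ?thesis
  proof (rule absolutely_continuous_on_dominated[OF f f, of _ "exp R / 2"])
    fix x y assume xy: "x \<in> {a..b}" "y \<in> {a..b}"
    have "norm (exp (f x) - exp (f y)) \<le> exp R * norm (f x - f y)"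
    proof (rule field_differentiable_bound[of "cball 0 R" exp exp])
      fix z :: complex assume "z \<in> cball 0 R"
      then show "norm (exp z) \<le> exp R"
        using norm_exp[of z] by (auto intro: order_trans)
      show "(exp has_field_derivative exp z) (at z within cball 0 R)"
        by (rule DERIV_subset[OF DERIV_exp]) simp
    qed (use R xy in auto)
    then show "norm (exp (f x) - exp (f y)) \<le> exp R / 2 * (norm (f x - f y) + norm (f x - f y))"
      by simp
  qed
qed

lemma absolutely_continuous_on_cmult:
  assumes f: "absolutely_continuous_on S f"
  shows "absolutely_continuous_on S (\<lambda>x. a * f x)"
  by (rule absolutely_continuous_on_dominated[OF f f, of _ "norm a / 2"])
     (simp add: norm_mult flip: right_diff_distrib)

text \<open>The functions \<open>p z = exp z\<close> and \<open>p z = z * exp z\<close> and their derivatives are all bounded by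
  \<open>(1 + norm z) * exp (Re z)\<close>. By the chain rule \<open>p (t \<psi>)\<close> obeys \<open>exponential_bounds\<close> in
  both cases, with constants that come from \<open>C\<close> and \<open>C'\<close> alone, and the uniform bound
  applies.\<close>

lemma exp_symbol_multipliers:
  fixes \<alpha> c C C' :: real
  assumes \<alpha>: "\<alpha> > 0" and c: "c > 0" and C: "C > 0" and C': "C' > 0"
  obtains K where "K \<ge> 0"
    "\<And>\<psi> t. admissible_symbol \<alpha> c C C' \<psi> \<Longrightarrow> t > 0 \<Longrightarrow>
      L1_multiplier (\<lambda>k. exp (of_real t * \<psi> k)) \<and>
      L1_op_norm (multiplier_op (\<lambda>k. exp (of_real t * \<psi> k))) \<le> ennreal K \<and>
      L1_multiplier (\<lambda>k. \<psi> k * exp (of_real t * \<psi> k)) \<and>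
      L1_op_norm (multiplier_op (\<lambda>k. \<psi> k * exp (of_real t * \<psi> k))) \<le> ennreal (K / t)"
proof -
  define L where "L = 1 + C"
  have L: "L \<ge> 0" "C' * L \<ge> 0" using C C' by (auto simp: L_def)
  from uniform_fcoeff_bound[OF \<alpha> c L]
  obtain K where K: "\<forall>g t F. t > 0 \<and> absolutely_continuous_on {-pi..pi} g \<and> g pi = g (-pi) \<and>
      exponential_bounds \<alpha> c L (C' * L) t g \<and> finite F \<longrightarrow> (\<Sum>n\<in>F. norm (fcoeff g n)) \<le> K" ..
  show ?thesis
  proof (rule that[of "max K 0"])
    fix \<psi> t assume adm: "admissible_symbol \<alpha> c C C' \<psi>" and t: "t > (0::real)"
    have per: "periodic_2pi \<psi>" and ac: "absolutely_continuous_on {-pi..pi} \<psi>"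
      using adm by (auto simp: admissible_symbol_def)
    have \<psi>d: "AE k in torus. \<exists>d. (\<psi> has_vector_derivative d) (at k) \<and> norm d \<le> C' * \<bar>k\<bar> powr (\<alpha> - 1)"
      using adm by (auto simp: admissible_symbol_def)
    note \<psi>b = admissible_symbol_bounds[OF adm \<alpha>]
    have main: "L1_multiplier (\<lambda>k. of_real r * p (of_real t * \<psi> k)) \<and>
        L1_op_norm (multiplier_op (\<lambda>k. of_real r * p (of_real t * \<psi> k))) \<le> ennreal (r * max K 0)"
      if r: "r \<ge> 0" and acp: "absolutely_continuous_on {-pi..pi} (\<lambda>k. p (of_real t * \<psi> k))"
        and p: "\<And>z. norm (p z) \<le> (1 + norm z) * exp (Re z)"
        and p': "\<And>z. (p has_field_derivative p' z) (at z)"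
        and p'b: "\<And>z. norm (p' z) \<le> (1 + norm z) * exp (Re z)"
      for r :: real and p p' :: "complex \<Rightarrow> complex"
    proof -
      define g where "g k = p (of_real t * \<psi> k)" for k
      have z: "(1 + norm (of_real t * \<psi> k)) * exp (Re (of_real t * \<psi> k))
          \<le> L * (1 + t * \<bar>k\<bar> powr \<alpha>) * exp (- (c * (t * \<bar>k\<bar> powr \<alpha>)))" if k: "k \<in> {-pi..pi}" for k
      proof (rule mult_mono)
        define x where "x = t * \<bar>k\<bar> powr \<alpha>"
        have x: "x \<ge> 0" using t by (simp add: x_def)
        have "norm (of_real t * \<psi> k) = t * norm (\<psi> k)" using t by (simp add: norm_mult)
        also have "\<dots> \<le> t * (C * \<bar>k\<bar> powr \<alpha>)" using t by (intro mult_left_mono \<psi>b k) auto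
        finally have "norm (of_real t * \<psi> k) \<le> C * x" by (simp add: x_def mult_ac)
        then have "1 + norm (of_real t * \<psi> k) \<le> L * (1 + x)"
          using x C by (simp add: L_def algebra_simps)
        then show "1 + norm (of_real t * \<psi> k) \<le> L * (1 + t * \<bar>k\<bar> powr \<alpha>)" by (simp add: x_def)
        have "Re (of_real t * \<psi> k) = t * Re (\<psi> k)" by simp
        also have "\<dots> \<le> t * (- c * \<bar>k\<bar> powr \<alpha>)" using t by (intro mult_left_mono \<psi>b k) auto
        finally show "exp (Re (of_real t * \<psi> k)) \<le> exp (- (c * (t * \<bar>k\<bar> powr \<alpha>)))"
          by (simp add: mult_ac)
        show "0 \<le> L * (1 + t * \<bar>k\<bar> powr \<alpha>)" using t L by simp
      qed simp
      have gper: "periodic_2pi g" using per by (simp add: periodic_2pi_def g_def)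
      have gd: "AE k in torus. \<exists>d. (g has_vector_derivative d) (at k) \<and>
        norm d \<le> C' * L * (t * \<bar>k\<bar> powr (\<alpha> - 1)) * (1 + t * \<bar>k\<bar> powr \<alpha>) * exp (- (c * (t * \<bar>k\<bar> powr \<alpha>)))"
        using \<psi>d AE_space
      proof eventually_elim
        case (elim k)
        then obtain d where d: "(\<psi> has_vector_derivative d) (at k)" "norm d \<le> C' * \<bar>k\<bar> powr (\<alpha> - 1)"
          and k: "k \<in> {-pi..pi}" by auto
        have "((\<lambda>k. of_real t * \<psi> k) has_vector_derivative of_real t * d) (at k)"
          using d(1) by (rule has_vector_derivative_mult_right)
        from field_vector_diff_chain_at[OF this p']
        have 1: "(g has_vector_derivative (of_real t * d * p' (of_real t * \<psi> k))) (at k)"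
          by (simp add: o_def g_def[abs_def])
        have "norm (of_real t * d * p' (of_real t * \<psi> k)) = t * norm d * norm (p' (of_real t * \<psi> k))"
          using t by (simp add: norm_mult)
        also have "\<dots> \<le> t * (C' * \<bar>k\<bar> powr (\<alpha> - 1)) * (L * (1 + t * \<bar>k\<bar> powr \<alpha>) * exp (- (c * (t * \<bar>k\<bar> powr \<alpha>))))"
          by (intro mult_mono d(2) order_trans[OF p'b z[OF k]]) (use t C' in auto)
        also have "\<dots> = C' * L * (t * \<bar>k\<bar> powr (\<alpha> - 1)) * (1 + t * \<bar>k\<bar> powr \<alpha>) * exp (- (c * (t * \<bar>k\<bar> powr \<alpha>)))"
          by (simp only: mult_ac)
        finally show ?case using 1 by blast
      qed
      have bound: "(\<Sum>n\<in>F. norm (fcoeff g n)) \<le> max K 0" if "finite F" for F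
      proof -
        have "(\<Sum>n\<in>F. norm (fcoeff g n)) \<le> K"
        proof (intro K[rule_format] conjI t that)
          show "absolutely_continuous_on {-pi..pi} g" using acp by (simp add: g_def[abs_def])
          show "g pi = g (-pi)" using periodic_2pi_shift[OF gper, of "-pi" 1] by simp
          show "exponential_bounds \<alpha> c L (C' * L) t g"
            unfolding exponential_bounds_def using gd order_trans[OF p z] by (simp add: g_def)
        qed (rule t)
        then show ?thesis by simp
      qed
      have gdiff: "AE k in torus. \<exists>d. (g has_vector_derivative d) (at k)"
        using gd by eventually_elim blast
      from L1_multiplier_periodic[OF _ gper gdiff bound r] acp
      show ?thesis by (simp add: g_def[abs_def])
    qed
    have ace: "absolutely_continuous_on {-pi..pi} (\<lambda>k. exp (of_real t * \<psi> k))"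
      by (intro absolutely_continuous_on_exp absolutely_continuous_on_cmult ac)
    have 1: "L1_multiplier (\<lambda>k. of_real 1 * exp (of_real t * \<psi> k)) \<and>
        L1_op_norm (multiplier_op (\<lambda>k. of_real 1 * exp (of_real t * \<psi> k))) \<le> ennreal (1 * max K 0)"
      by (rule main[OF _ ace _ DERIV_exp]) (auto simp: mult_le_cancel_right1)
    have 2: "L1_multiplier (\<lambda>k. of_real (1 / t) * (of_real t * \<psi> k * exp (of_real t * \<psi> k))) \<and>
        L1_op_norm (multiplier_op (\<lambda>k. of_real (1 / t) * (of_real t * \<psi> k * exp (of_real t * \<psi> k)))) \<le> ennreal (1 / t * max K 0)"
    proof (rule main[of "1 / t" "\<lambda>z. z * exp z" "\<lambda>z. (1 + z) * exp z"])
      show "absolutely_continuous_on {-pi..pi} (\<lambda>k. of_real t * \<psi> k * exp (of_real t * \<psi> k))"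
        by (intro absolutely_continuous_on_mult ace absolutely_continuous_on_cmult ac)
      fix z :: complex
      show "norm (z * exp z) \<le> (1 + norm z) * exp (Re z)" by (simp add: norm_mult)
      show "((\<lambda>z. z * exp z) has_field_derivative (1 + z) * exp z) (at z)"
        by (auto intro!: derivative_eq_intros simp: algebra_simps)
      show "norm ((1 + z) * exp z) \<le> (1 + norm z) * exp (Re z)"
        using norm_triangle_ineq[of 1 z] by (simp add: norm_mult mult_right_mono)
    qed (use t in simp)
    have "of_real (1 / t) * (of_real t * \<psi> k * exp (of_real t * \<psi> k)) = \<psi> k * exp (of_real t * \<psi> k)" for k
      using t by simp
    with 1 2 show "L1_multiplier (\<lambda>k. exp (of_real t * \<psi> k)) \<and>
      L1_op_norm (multiplier_op (\<lambda>k. exp (of_real t * \<psi> k))) \<le> ennreal (max K 0) \<and>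
      L1_multiplier (\<lambda>k. \<psi> k * exp (of_real t * \<psi> k)) \<and>
      L1_op_norm (multiplier_op (\<lambda>k. \<psi> k * exp (of_real t * \<psi> k))) \<le> ennreal (max K 0 / t)" by simp
  qed simp
qed

text \<open>The case \<open>t = 0\<close>, which the change of scale excludes.\<close>

lemma L1_multiplier_one: "L1_multiplier (\<lambda>k. 1)" "L1_op_norm (multiplier_op (\<lambda>k. 1)) \<le> ennreal 1"
proof -
  define a where "a j = (if j = 0 then 1 else 0 :: complex)" for j :: nat
  have n: "(\<lambda>j. norm (a j)) sums 1"
    using sums_single[of 0 "\<lambda>_. 1 :: real"] by (simp add: a_def if_distrib cong: if_cong)
  have s: "(\<lambda>j. a j * cis (of_int 0 * k)) sums 1" for k
    using sums_single[of 0 "\<lambda>_. 1 :: complex"] by (simp add: a_def cong: if_cong)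
  show "L1_multiplier (\<lambda>k. 1)" "L1_op_norm (multiplier_op (\<lambda>k. 1)) \<le> ennreal 1"
    using L1_multiplier_trigonometric_series[of "\<lambda>_. 1" a 1 "\<lambda>_. 0"] n s by (simp_all add: sums_iff)
qed

section \<open>Generalized derivatives of periodic functions\<close>

text \<open>A bounded interval is covered by finitely many translates of one period.\<close>

lemma periodic_2pi_set_integrable:
  assumes f: "set_integrable lebesgue {-pi..pi} f" and per: "periodic_2pi f"
  shows "set_integrable lebesgue {a..b} f"
proof -
  define I where "I n = {-pi - 2 * pi * of_int n..pi - 2 * pi * of_int n}" for n :: int
  have shift: "set_integrable lebesgue (I n) f" for n
  proof -
    have "integrable lebesgue (\<lambda>x. indicator {-pi..pi} (2 * pi * of_int n + 1 * x) *\<^sub>R f (2 * pi * of_int n + 1 * x))"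
      using lebesgue_integrable_real_affine[OF f[unfolded set_integrable_def], of 1 "2 * pi * of_int n"] by simp
    moreover have "indicator {-pi..pi} (2 * pi * of_int n + 1 * x) *\<^sub>R f (2 * pi * of_int n + 1 * x)
        = indicator (I n) x *\<^sub>R f x" for x
      using periodic_2pi_shift[OF per, of x n] by (auto simp: indicator_def I_def add.commute)
    ultimately show ?thesis by (simp only: set_integrable_def)
  qed
  define m where "m = \<lceil>(\<bar>a\<bar> + \<bar>b\<bar> + pi) / (2 * pi)\<rceil>"
  have "{a..b} \<subseteq> (\<Union>n\<in>{-m..m}. I n)"
  proof
    fix x assume x: "x \<in> {a..b}"
    obtain n where n: "x + 2 * pi * of_int n \<in> {-pi..pi}" by (rule reduce_mod_2pi)
    then have "\<bar>2 * pi * real_of_int n\<bar> \<le> \<bar>a\<bar> + \<bar>b\<bar> + pi" using x by (auto simp: abs_le_iff)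
    then have "\<bar>real_of_int n\<bar> \<le> (\<bar>a\<bar> + \<bar>b\<bar> + pi) / (2 * pi)"
      by (simp add: abs_mult pos_le_divide_eq mult.commute)
    then have "\<bar>real_of_int n\<bar> \<le> real_of_int m" unfolding m_def by linarith
    then have "n \<in> {-m..m}" by auto
    moreover have "x \<in> I n" using n by (auto simp: I_def)
    ultimately show "x \<in> (\<Union>n\<in>{-m..m}. I n)" by blast
  qed
  moreover have "set_integrable lebesgue (\<Union>n\<in>{-m..m}. I n) f"
    by (intro set_integrable_UN shift) (auto simp: I_def)
  ultimately show ?thesis by (rule set_integrable_subset[rotated 2]) auto
qed

lemma integrable_lebesgue_on_eq_set_integrable:
  fixes f :: "real \<Rightarrow> complex"
  shows "integrable (lebesgue_on {a..b}) f \<longleftrightarrow> set_integrable lebesgue {a..b} f"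
  by (simp add: integrable_restrict_space set_integrable_def)

lemma test_functionD:
  assumes "test_function \<phi>"
  shows "(\<phi> has_real_derivative deriv \<phi> x) (at x)" "continuous_on UNIV \<phi>" "continuous_on UNIV (deriv \<phi>)"
    "\<exists>R>0. \<forall>x. \<bar>x\<bar> \<ge> R \<longrightarrow> \<phi> x = 0 \<and> deriv \<phi> x = 0"
proof -
  have "((deriv ^^ 0) \<phi>) differentiable (at x)" "((deriv ^^ 1) \<phi>) differentiable (at x)" for x
    using assms unfolding test_function_def by blast+
  then have d: "\<phi> differentiable (at x)" "deriv \<phi> differentiable (at x)" for x by auto
  show der: "(\<phi> has_real_derivative deriv \<phi> x) (at x)" for x
    using d by (simp add: DERIV_deriv_iff_real_differentiable)
  show "continuous_on UNIV \<phi>" "continuous_on UNIV (deriv \<phi>)"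
    using d by (auto intro!: continuous_at_imp_continuous_on differentiable_imp_continuous_within)
  have "bounded {x. \<phi> x \<noteq> 0}"
    using assms bounded_subset[OF compact_imp_bounded closure_subset] unfolding test_function_def by blast
  then obtain B where B: "\<And>x. \<phi> x \<noteq> 0 \<Longrightarrow> \<bar>x\<bar> \<le> B" unfolding bounded_iff by auto
  have z: "\<phi> x = 0" if "\<bar>x\<bar> > B" for x using B that by fastforce
  have "deriv \<phi> x = 0" if x: "\<bar>x\<bar> > B" for x
  proof -
    have op: "open {x. \<bar>x\<bar> > B}" by (intro open_Collect_less continuous_intros)
    have "((\<lambda>_. 0) has_real_derivative 0) (at x)" by simp
    then have "(\<phi> has_real_derivative 0) (at x)"
      by (rule has_field_derivative_transform_within_open[OF _ op]) (use x z in auto)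
    with der[of x] show ?thesis by (rule DERIV_unique)
  qed
  with z show "\<exists>R>0. \<forall>x. \<bar>x\<bar> \<ge> R \<longrightarrow> \<phi> x = 0 \<and> deriv \<phi> x = 0"
    by (intro exI[of _ "\<bar>B\<bar> + 1"]) auto
qed

text \<open>Absolute continuity is available on one period only. The fundamental theorem is therefore
  applied to \<open>g\<close> times the translated test function on that period, and the results are
  added up. The boundary terms telescope, and the outermost ones lie outside the support of
  the test function.\<close>

lemma periodic_integration_by_parts:
  assumes per: "periodic_2pi g" and ac: "absolutely_continuous_on {-pi..pi} g"
    and hper: "periodic_2pi h" and N: "negligible N"
    and d: "\<And>k. k \<in> {-pi..pi} - N \<Longrightarrow> (g has_vector_derivative h k) (at k)"
    and hi: "set_integrable lebesgue {-pi..pi} h" and \<phi>: "test_function \<phi>"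
  shows "(\<integral>x. g x * of_real (deriv \<phi> x) \<partial>lebesgue) = - (\<integral>x. h x * of_real (\<phi> x) \<partial>lebesgue)"
proof -
  note \<phi>d = test_functionD(1)[OF \<phi>] and c\<phi> = test_functionD(2,3)[OF \<phi>]
  obtain R where R: "R > 0" "\<And>x. \<bar>x\<bar> \<ge> R \<Longrightarrow> \<phi> x = 0" "\<And>x. \<bar>x\<bar> \<ge> R \<Longrightarrow> deriv \<phi> x = 0"
    using test_functionD(4)[OF \<phi>] by blast
  have gc: "continuous_on UNIV g"
    by (intro continuous_on_periodic_2pi absolutely_continuous_on_imp_continuous_on[OF ac] per) auto
  let ?P = "\<lambda>x. g x * of_real (\<phi> x)"
  let ?D = "\<lambda>x. g x * of_real (deriv \<phi> x) + h x * of_real (\<phi> x)"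
  define p where "p n = -pi + 2 * pi * of_int n" for n :: int
  have p1: "p (n + 1) = p n + 2 * pi" for n by (simp add: p_def algebra_simps)
  have period: "(?D has_integral (?P (p (n + 1)) - ?P (p n))) {p n..p (n + 1)}" for n
  proof -
    define s where "s = 2 * pi * of_int n"
    have gs: "g (k + s) = g k" and hs: "h (k + s) = h k" for k
      unfolding s_def by (intro periodic_2pi_shift per hper)+
    have \<phi>s: "((\<lambda>k. \<phi> (k + s)) has_real_derivative deriv \<phi> (k + s)) (at k)" for k
      using DERIV_shift[THEN iffD1, OF \<phi>d] .
    have "bounded ((\<lambda>k. deriv \<phi> (k + s)) ` {-pi..pi})"
      by (intro compact_imp_bounded compact_continuous_image compact_Icc
          continuous_on_compose2[OF c\<phi>(2)] continuous_intros) auto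
    then obtain B where B: "\<And>k. k \<in> {-pi..pi} \<Longrightarrow> norm (deriv \<phi> (k + s)) \<le> B"
      unfolding bounded_iff by (meson imageI)
    have ac\<phi>: "absolutely_continuous_on {-pi..pi} (\<lambda>k. complex_of_real (\<phi> (k + s)))"
    proof (rule absolutely_continuous_on_Lipschitz[of _ _ B])
      fix x y assume xy: "x \<in> {-pi..pi}" "y \<in> {-pi..pi}"
      have "norm (\<phi> (x + s) - \<phi> (y + s)) \<le> B * norm (x - y)"
        by (rule field_differentiable_bound[OF convex_closed_interval, of "-pi" pi _ "\<lambda>k. deriv \<phi> (k + s)"])
           (use xy B in \<open>auto intro: has_field_derivative_at_within[OF \<phi>s]\<close>)
      then show "norm (complex_of_real (\<phi> (x + s)) - complex_of_real (\<phi> (y + s))) \<le> B * \<bar>x - y\<bar>"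
        by (simp flip: of_real_diff)
    qed
    have "((\<lambda>k. ?D (k + s)) has_integral (g pi * of_real (\<phi> (pi + s)) - g (-pi) * of_real (\<phi> (-pi + s)))) {-pi..pi}"
    proof (rule fundamental_theorem_of_calculus_absolutely_continuous[OF _ absolutely_continuous_on_mult[OF ac ac\<phi>] N])
      fix k assume k: "k \<in> {-pi..pi} - N"
      have "((\<lambda>k. complex_of_real (\<phi> (k + s))) has_vector_derivative of_real (deriv \<phi> (k + s))) (at k)"
        using \<phi>s by (intro has_vector_derivative_of_real) (simp add: has_real_derivative_iff_has_vector_derivative)
      from has_vector_derivative_mult[OF d[OF k] this]
      show "((\<lambda>k. g k * of_real (\<phi> (k + s))) has_vector_derivative ?D (k + s)) (at k within {-pi..pi})"
        unfolding gs hs by (rule has_vector_derivative_at_within)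
    qed simp
    then have "((\<lambda>k. ?D (k + s)) has_integral (?P (pi + s) - ?P (-pi + s))) {-pi..pi}"
      unfolding gs .
    then have "(?D has_integral (?P (pi + s) - ?P (-pi + s))) {-pi + s..pi + s}"
      using has_integral_shift_Icc_real[of ?D s _ "-pi" pi] by (simp add: add.commute o_def)
    moreover have "p n = -pi + s" "p (n + 1) = pi + s" by (simp_all add: p_def s_def algebra_simps)
    ultimately show ?thesis by simp
  qed
  have many: "(?D has_integral (?P (p (n + int M)) - ?P (p n))) {p n..p (n + int M)}" for n M
  proof (induction M)
    case 0 show ?case using has_integral_refl(2)[of ?D "p n"] by (simp flip: box_real)
  next
    case (Suc M)
    have e: "n + int (Suc M) = (n + int M) + 1" by simp
    have le: "p n \<le> p (n + int M)" "p (n + int M) \<le> p (n + int (Suc M))"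
      by (simp_all add: p_def algebra_simps)
    from has_integral_combine[OF le Suc period[of "n + int M", folded e]]
    show ?case by simp
  qed
  obtain m :: nat where m: "real m \<ge> R" using real_arch_simple by blast
  have big: "R \<le> p (int m + 1)" "p (- int m) \<le> - R"
  proof -
    have "1 * real m \<le> pi * real m" using pi_ge_two by (intro mult_right_mono) auto
    then show "R \<le> p (int m + 1)" "p (- int m) \<le> - R"
      using m by (simp_all add: p_def algebra_simps) (use pi_gt_zero in linarith)+
  qed
  have ends: "?P (p (int m + 1)) = 0" "?P (p (- int m)) = 0" using big R by simp_all
  have "- int m + int (2 * m + 1) = int m + 1" by simp
  then have "(?D has_integral 0) {p (- int m)..p (int m + 1)}"
    using many[of "- int m" "2 * m + 1"] by (simp only: ends diff_0_right)
  then have D0: "(?D has_integral 0) UNIV"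
    by (rule has_integral_on_superset) (use big R in \<open>auto simp: not_le\<close>)
  have ind: "integrable lebesgue f" if "set_integrable lebesgue {-R..R} f" "\<And>x. \<bar>x\<bar> \<ge> R \<Longrightarrow> f x = 0" for f :: "real \<Rightarrow> complex"
  proof -
    have "indicator {-R..R} x *\<^sub>R f x = f x" for x using that(2)[of x] by (auto simp: indicator_def)
    then show ?thesis using that(1) by (simp add: set_integrable_def)
  qed
  have i1: "integrable lebesgue (\<lambda>x. g x * of_real (deriv \<phi> x))"
  proof (rule ind)
    have "continuous_on {-R..R} (\<lambda>x. g x * of_real (deriv \<phi> x))"
      by (intro continuous_intros continuous_on_subset[OF gc] continuous_on_subset[OF c\<phi>(2)]) auto
    then show "set_integrable lebesgue {-R..R} (\<lambda>x. g x * of_real (deriv \<phi> x))"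
      by (rule absolutely_integrable_continuous_real)
  qed (use R in simp)
  have i2: "integrable lebesgue (\<lambda>x. h x * of_real (\<phi> x))"
  proof (rule ind)
    have "bounded (\<phi> ` {-R..R})"
      by (intro compact_imp_bounded compact_continuous_image continuous_on_subset[OF c\<phi>(1)] compact_Icc) auto
    then have b: "bounded ((\<lambda>x. complex_of_real (\<phi> x)) ` {-R..R})"
      unfolding bounded_iff by auto
    have m: "(\<lambda>x. complex_of_real (\<phi> x)) \<in> borel_measurable (lebesgue_on {-R..R})"
      by (intro continuous_imp_measurable_on_sets_lebesgue continuous_intros continuous_on_subset[OF c\<phi>(1)]) auto
    show "set_integrable lebesgue {-R..R} (\<lambda>x. h x * of_real (\<phi> x))"
      using absolutely_integrable_bounded_measurable_product[OF bilinear_times m _ b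
          periodic_2pi_set_integrable[OF hi hper]]
      by (simp add: mult.commute)
  qed (use R in simp)
  have "(?D has_integral (\<integral>x. ?D x \<partial>lebesgue)) UNIV"
    by (intro has_integral_integral_lebesgue Bochner_Integration.integrable_add i1 i2)
  then have "(\<integral>x. ?D x \<partial>lebesgue) = 0" using D0 by (rule has_integral_unique)
  then show ?thesis using i1 i2 by (simp add: eq_neg_iff_add_eq_0)
qed

text \<open>The generalized derivative is taken to be the pointwise one, with the value \<open>0\<close> where it
  does not exist. It is then periodic, and the condition \<open>r * (\<alpha> - 1) > -1\<close> is what makes
  the \<open>r\<close>-th power of its bound \<open>C' * \<bar>k\<bar> powr (\<alpha> - 1)\<close> integrable at \<open>0\<close>.\<close>

lemma admissible_symbol_in_W1_per:
  assumes adm: "admissible_symbol \<alpha> c C C' \<psi>" and \<alpha>: "\<alpha> > 0" and C': "C' > 0"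
    and r: "r > 0" "r * (\<alpha> - 1) > -1"
  shows "\<psi> \<in> W1_per r"
proof -
  have per: "periodic_2pi \<psi>" and ac: "absolutely_continuous_on {-pi..pi} \<psi>"
    and \<psi>d: "AE k in torus. \<exists>d. (\<psi> has_vector_derivative d) (at k) \<and> norm d \<le> C' * \<bar>k\<bar> powr (\<alpha> - 1)"
    using adm by (auto simp: admissible_symbol_def)
  have cont: "continuous_on UNIV \<psi>"
    by (intro continuous_on_periodic_2pi absolutely_continuous_on_imp_continuous_on[OF ac] per) auto
  have contI: "continuous_on S \<psi>" for S by (rule continuous_on_subset[OF cont]) simp
  define h where "h k = (if \<exists>d. (\<psi> has_vector_derivative d) (at k)
      then vector_derivative \<psi> (at k) else 0)" for k
  have h_eq: "h k = d" if "(\<psi> has_vector_derivative d) (at k)" for k d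
    using that vector_derivative_at[OF that] by (auto simp: h_def)
  have hper: "periodic_2pi h"
  proof -
    have shift: "(\<psi> has_vector_derivative d) (at (x + a))"
      if "(\<psi> has_vector_derivative d) (at x)" and "\<And>y. \<psi> (y - a) = \<psi> y" for d x a
    proof -
      have "((\<lambda>y. y - a) has_vector_derivative 1) (at (x + a))"
        by (auto intro!: derivative_eq_intros)
      moreover have "(\<psi> has_vector_derivative d) (at (x + a - a))" using that(1) by simp
      ultimately have "((\<psi> \<circ> (\<lambda>y. y - a)) has_vector_derivative (1 *\<^sub>R d)) (at (x + a))"
        by (rule vector_diff_chain_at)
      then show ?thesis using that(2) by (simp add: o_def)
    qed
    have "\<psi> (y - 2 * pi) = \<psi> y" "\<psi> (y - - (2 * pi)) = \<psi> y" for y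
      using periodic_2pi_shift[OF per, of y 1] periodic_2pi_shift[OF per, of y "-1"] by auto
    then have iff: "(\<psi> has_vector_derivative d) (at (x + 2 * pi)) \<longleftrightarrow> (\<psi> has_vector_derivative d) (at x)" for d x
      using shift[of d x "2 * pi"] shift[of d "x + 2 * pi" "- (2 * pi)"] by auto
    then show ?thesis
      unfolding periodic_2pi_def h_def vector_derivative_def by simp
  qed
  define N where "N = {k \<in> {-pi..pi}. \<not> (\<exists>d. (\<psi> has_vector_derivative d) (at k) \<and> norm d \<le> C' * \<bar>k\<bar> powr (\<alpha> - 1))}"
  have N: "negligible N"
    using AE_lebesgue_on_negligible[OF \<psi>d] by (simp add: N_def)
  have hd: "(\<psi> has_vector_derivative h k) (at k)" "norm (h k) \<le> C' * \<bar>k\<bar> powr (\<alpha> - 1)"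
    if "k \<in> {-pi..pi} - N" for k
    using that h_eq by (auto simp: N_def)
  have hb: "AE k in torus. norm (h k) \<le> C' * \<bar>k\<bar> powr (\<alpha> - 1)"
    using \<psi>d by eventually_elim (use h_eq in auto)
  have "(h has_integral (\<psi> pi - \<psi> (-pi))) {-pi..pi}"
    by (rule fundamental_theorem_of_calculus_absolutely_continuous[OF _ ac N])
       (simp, rule has_vector_derivative_at_within[OF hd(1)])
  then have hm: "h \<in> borel_measurable torus"
    by (intro integrable_imp_measurable) (auto simp: integrable_on_def)
  have powi: "integrable torus (\<lambda>k. D * \<bar>k\<bar> powr a)" if "a > -1" "D \<ge> 0" for a D
  proof -
    have "((\<lambda>k. D * k powr a) has_integral D * (pi powr (a + 1) / (a + 1))) {0..pi}"
      by (intro has_integral_mult_right has_integral_powr_from_0) (use that in auto)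
    then show ?thesis
    proof (rule torus_integral_le_even(1))
      have "(\<lambda>k::real. k) \<in> borel_measurable torus"
        by (intro continuous_imp_measurable_on_sets_lebesgue) auto
      then show "(\<lambda>k. D * \<bar>k\<bar> powr a) \<in> borel_measurable torus" by measurable
    qed (use that in auto)
  qed
  have hi: "integrable torus h"
    by (rule Bochner_Integration.integrable_bound[OF powi[of "\<alpha> - 1" C'] hm])
       (use hb \<alpha> C' in \<open>auto elim: eventually_mono\<close>)
  then have his: "set_integrable lebesgue {-pi..pi} h"
    by (simp add: integrable_lebesgue_on_eq_set_integrable)
  have gen: "generalized_derivative \<psi> h"
    unfolding generalized_derivative_def locally_integrable_def
  proof (intro conjI allI impI)
    show "integrable (lebesgue_on {a..b}) \<psi>" for a b
      by (intro continuous_imp_integrable_real contI)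
    show "integrable (lebesgue_on {a..b}) h" for a b
      unfolding integrable_lebesgue_on_eq_set_integrable by (rule periodic_2pi_set_integrable[OF his hper])
    show "(\<integral>x. \<psi> x * of_real (deriv \<phi> x) \<partial>lebesgue) = - (\<integral>x. h x * of_real (\<phi> x) \<partial>lebesgue)"
      if "test_function \<phi>" for \<phi>
      by (rule periodic_integration_by_parts[OF per ac hper N hd(1) his that])
  qed
  have "in_Lr r {-pi..pi} \<psi>"
    unfolding in_Lr_def
  proof
    show "\<psi> \<in> borel_measurable torus"
      by (intro continuous_imp_measurable_on_sets_lebesgue contI) auto
    show "integrable torus (\<lambda>x. norm (\<psi> x) powr r)"
      by (intro continuous_imp_integrable_real continuous_on_powr' continuous_intros contI) (use r in auto)
  qed
  moreover have "in_Lr r {-pi..pi} h"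
    unfolding in_Lr_def
  proof
    have "integrable torus (\<lambda>k. C' powr r * \<bar>k\<bar> powr (r * (\<alpha> - 1)))"
      by (rule powi) (use r in auto)
    then show "integrable torus (\<lambda>x. norm (h x) powr r)"
    proof (rule Bochner_Integration.integrable_bound)
      show "(\<lambda>x. norm (h x) powr r) \<in> borel_measurable torus" using hm by measurable
      show "AE x in torus. norm (norm (h x) powr r) \<le> norm (C' powr r * \<bar>x\<bar> powr (r * (\<alpha> - 1)))"
        using hb
      proof eventually_elim
        case (elim x)
        then have "norm (h x) powr r \<le> (C' * \<bar>x\<bar> powr (\<alpha> - 1)) powr r"
          using r by (intro powr_mono2) auto
        also have "\<dots> = C' powr r * \<bar>x\<bar> powr (r * (\<alpha> - 1))"
          using C' by (simp add: powr_mult powr_powr mult.commute)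
        finally show ?case by simp
      qed
    qed
  qed (rule hm)
  ultimately show ?thesis
    unfolding W1_per_def using per gen by blast
qed

section \<open>Sobolev regularity and semigroup estimates\<close>

theorem theorem4p1:
  fixes \<alpha> c C C' :: real
  assumes "\<alpha> > 0" and "c > 0" and "C > 0" and "C' > 0"
  shows "(\<forall>\<psi>. admissible_symbol \<alpha> c C C' \<psi> \<longrightarrow>
            (\<alpha> > 1/2 \<longrightarrow> \<psi> \<in> W1_per 2) \<and>
            (\<alpha> \<le> 1/2 \<longrightarrow> (\<forall>r. 1 < r \<and> r < 1 / (1 - \<alpha>) \<longrightarrow> \<psi> \<in> W1_per r))) \<and>
         (\<exists>K M :: real. K > 0 \<and> M > 0 \<and>
            (\<forall>\<psi>. admissible_symbol \<alpha> c C C' \<psi> \<longrightarrow>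
               (\<forall>t\<ge>0. L1_multiplier (\<lambda>k. exp (of_real t * \<psi> k)) \<and>
                  L1_op_norm (multiplier_op (\<lambda>k. exp (of_real t * \<psi> k))) \<le> ennreal K) \<and>
               (\<forall>t>0. L1_multiplier (\<lambda>k. \<psi> k * exp (of_real t * \<psi> k)) \<and>
                  L1_op_norm (multiplier_op (\<lambda>k. \<psi> k * exp (of_real t * \<psi> k))) \<le> ennreal (M / t))))"
proof
  show "\<forall>\<psi>. admissible_symbol \<alpha> c C C' \<psi> \<longrightarrow>
            (\<alpha> > 1/2 \<longrightarrow> \<psi> \<in> W1_per 2) \<and>
            (\<alpha> \<le> 1/2 \<longrightarrow> (\<forall>r. 1 < r \<and> r < 1 / (1 - \<alpha>) \<longrightarrow> \<psi> \<in> W1_per r))"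
  proof (intro allI impI conjI; (elim conjE)?)
    fix \<psi> assume adm: "admissible_symbol \<alpha> c C C' \<psi>"
    note W = admissible_symbol_in_W1_per[OF adm assms(1,4)]
    show "\<psi> \<in> W1_per 2" if "\<alpha> > 1/2" using that by (intro W) auto
    show "\<psi> \<in> W1_per r" if "\<alpha> \<le> 1/2" "1 < r" "r < 1 / (1 - \<alpha>)" for r
    proof (rule W)
      have "r * (1 - \<alpha>) < 1" using that by (simp add: field_simps)
      then show "r * (\<alpha> - 1) > -1" by (simp add: algebra_simps)
    qed (use that in simp)
  qed
  obtain K where K: "K \<ge> 0"
    "\<And>\<psi> t. admissible_symbol \<alpha> c C C' \<psi> \<Longrightarrow> t > 0 \<Longrightarrow>
      L1_multiplier (\<lambda>k. exp (of_real t * \<psi> k)) \<and>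
      L1_op_norm (multiplier_op (\<lambda>k. exp (of_real t * \<psi> k))) \<le> ennreal K \<and>
      L1_multiplier (\<lambda>k. \<psi> k * exp (of_real t * \<psi> k)) \<and>
      L1_op_norm (multiplier_op (\<lambda>k. \<psi> k * exp (of_real t * \<psi> k))) \<le> ennreal (K / t)"
    using exp_symbol_multipliers[OF assms] by blast
  show "\<exists>K M :: real. K > 0 \<and> M > 0 \<and>
            (\<forall>\<psi>. admissible_symbol \<alpha> c C C' \<psi> \<longrightarrow>
               (\<forall>t\<ge>0. L1_multiplier (\<lambda>k. exp (of_real t * \<psi> k)) \<and>
                  L1_op_norm (multiplier_op (\<lambda>k. exp (of_real t * \<psi> k))) \<le> ennreal K) \<and>
               (\<forall>t>0. L1_multiplier (\<lambda>k. \<psi> k * exp (of_real t * \<psi> k)) \<and>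
                  L1_op_norm (multiplier_op (\<lambda>k. \<psi> k * exp (of_real t * \<psi> k))) \<le> ennreal (M / t)))"
  proof (intro exI[of _ "K + 1"] conjI allI impI)
    fix \<psi> t assume adm: "admissible_symbol \<alpha> c C C' \<psi>"
    have le: "ennreal K \<le> ennreal (K + 1)" by (intro ennreal_leI) simp
    {
      assume t: "t \<ge> (0::real)"
      have "L1_multiplier (\<lambda>k. exp (of_real t * \<psi> k)) \<and>
         L1_op_norm (multiplier_op (\<lambda>k. exp (of_real t * \<psi> k))) \<le> ennreal (K + 1)"
      proof (cases "t = 0")
        case True
        have "ennreal 1 \<le> ennreal (K + 1)" using K(1) by (intro ennreal_leI) simp
        with L1_multiplier_one True show ?thesis by (auto intro: order_trans)
      next
        case False
        with K(2)[OF adm, of t] t le show ?thesis by (auto intro: order_trans)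
      qed
      then show "L1_multiplier (\<lambda>k. exp (of_real t * \<psi> k))"
        "L1_op_norm (multiplier_op (\<lambda>k. exp (of_real t * \<psi> k))) \<le> ennreal (K + 1)" by auto
    }
    {
      assume t: "t > (0::real)"
      have "ennreal (K / t) \<le> ennreal ((K + 1) / t)"
        using t by (intro ennreal_leI divide_right_mono) auto
      with K(2)[OF adm t] show "L1_multiplier (\<lambda>k. \<psi> k * exp (of_real t * \<psi> k))"
        "L1_op_norm (multiplier_op (\<lambda>k. \<psi> k * exp (of_real t * \<psi> k))) \<le> ennreal ((K + 1) / t)"
        by (auto intro: order_trans)
    }
  qed (use K(1) in auto)
qed

end
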